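(* Let $\chi$ be a real and non-principal Dirichlet character. Suppose that for some $\epsilon>0$ we have $L(s,\chi)\neq 0$ for all $s\in\mathbb{C}$ with $\mathrm{Re}(s)>1-\epsilon$. Then there exists $\sigma$ with $1-\epsilon<\sigma<1$ such that the partial sums $\sum_{p\le x}\chi(p)p^{-\sigma}$ (over primes $p$) change sign only for a finite number of integers $x\ge 1$.
   Context: $p$ denotes a generic prime number. $L(s,\chi)$ is the Dirichlet $L$-function of $\chi$: $L(s,\chi)=\sum_{n=1}^\infty \chi(n)n^{-s}$, which for non-principal $\chi$ converges and is analytic for $\mathrm{Re}(s)>0$ (and is otherwise understood by analytic continuation). Saying that the partial sums $A(x)=\sum_{p\le x}\chi(p)p^{-\sigma}$ change sign only for a finite number of integers $x\ge1$ means that there is $x_0>0$ such that either $A(x)\ge 0$ for all $x\ge x_0$, or $A(x)\le 0$ for all $x\ge x_0$. *)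

theory Defs
  imports "HOL-Complex_Analysis.Complex_Analysis" "HOL-Computational_Algebra.Primes"
begin

definition dirichlet_character :: "nat \<Rightarrow> (nat \<Rightarrow> complex) \<Rightarrow> bool" where
  "dirichlet_character q chi \<longleftrightarrow>
     q > 0 \<and>
     (\<forall>m n. chi (m * n) = chi m * chi n) \<and>
     (\<forall>n. chi (n + q) = chi n) \<and>
     (\<forall>n. chi n \<noteq> 0 \<longleftrightarrow> coprime n q)"

definition principal_character :: "nat \<Rightarrow> nat \<Rightarrow> complex" where
  "principal_character q n = (if coprime n q then 1 else 0)"

definition real_character :: "(nat \<Rightarrow> complex) \<Rightarrow> bool" where
  "real_character chi \<longleftrightarrow> (\<forall>n. chi n \<in> \<real>)"

definition dirichlet_L_term :: "(nat \<Rightarrow> complex) \<Rightarrow> complex \<Rightarrow> nat \<Rightarrow> complex" where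
  "dirichlet_L_term chi s n = chi (Suc n) * of_nat (Suc n) powr (-s)"

text \<open>
  The value is that of the series wherever it converges (for a non-principal character this is
  exactly the half-plane of positive real part) and that of the analytic continuation from the
  half-plane of absolute convergence elsewhere.  The point 1 is left out of the domain of the
  continuation only because of the pole for principal characters; the complement of a point is
  connected, so the continued value is unique.  For a non-principal character
  the point 1 is covered by the series.
\<close>
definition dirichlet_L :: "(nat \<Rightarrow> complex) \<Rightarrow> complex \<Rightarrow> complex" where
  "dirichlet_L chi s =
     (if summable (dirichlet_L_term chi s) then suminf (dirichlet_L_term chi s)
      else (THE w. \<exists>f. f holomorphic_on - {1} \<and>
                       (\<forall>z. Re z > 1 \<longrightarrow> f z = suminf (dirichlet_L_term chi z)) \<and> f s = w))"

text \<open>Only used for real characters, where taking real parts loses nothing.\<close>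
definition prime_partial_sum :: "(nat \<Rightarrow> complex) \<Rightarrow> real \<Rightarrow> real \<Rightarrow> real" where
  "prime_partial_sum chi \<sigma> x =
     (\<Sum>p | prime p \<and> real p \<le> x. Re (chi p) * real p powr (-\<sigma>))"

definition finitely_many_sign_changes :: "(real \<Rightarrow> real) \<Rightarrow> bool" where
  "finitely_many_sign_changes A \<longleftrightarrow>
     (\<exists>x\<^sub>0>0. (\<forall>x\<ge>x\<^sub>0. A x \<ge> 0) \<or> (\<forall>x\<ge>x\<^sub>0. A x \<le> 0))"

end

theory Submission imports Defs "HOL-Number_Theory.Cong" begin

text \<open>
  Write \<open>P(s) = \<Sum> \<chi>(p) p\<^sup>-\<^sup>s\<close>.  By the Euler product \<open>P\<close> differs from \<open>log L(s, \<chi>)\<close> by a series that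
  converges for \<open>Re s > 1/2\<close>, so a zero-free half-plane continues \<open>P\<close> to the left of 1, and the
  Borel--Caratheodory inequality bounds the continuation linearly in \<open>\<bar>Im s\<bar>\<close>.  Newman's contour
  argument, with a contour whose size is a small power of \<open>N\<close>, then gives the rate \<open>O(N\<^sup>-\<^sup>\<eta>)\<close> for the
  convergence of \<open>\<Sum> \<chi>(p)/p\<close>.  Abel summation yields convergence of the series for \<open>P\<close> to a
  holomorphic function on \<open>Re s > 1 - \<eta>\<close>.  That function is not identically 0, so it is nonzero at
  some real \<open>\<sigma>\<close> just below 1, and the partial sums at \<open>\<sigma>\<close> eventually have the sign of their limit.
\<close>

section \<open>Abel summation of Dirichlet series\<close>

text \<open>Continuing a Dirichlet series does not make it converge, and convergence at 1 alone says
  nothing about points to the left of 1. The obstacle is to gain a rate that is a power of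
  \<open>N\<close>. On a contour of half-side \<open>R\<close> the error is of order 1/R + R^2
  N^(-\<delta>). The kernel decays like 1/R^2 on the horizontal sides, so a continuation that grows
  linearly in the height is still good enough there. This is why log |L| may be bounded crudely by
  |L| itself. The constants: \<delta> = \<epsilon>/3 leaves two further thirds of \<epsilon> for the
  concentric discs of Borel--Caratheodory, and R = N^(\<delta>/3) balances the two errors, whence
  the rate N^(-\<epsilon>/9). Capping \<epsilon> at 1/2 keeps the half-plane inside Re s > 1/2,
  where the prime powers contribute a holomorphic function. That the character is real enters at the
  very end: it makes the limit real, so that a nonzero limit has a sign.\<close>

lemma holomorphic_suminf_halfplane:
  fixes f :: "nat \<Rightarrow> complex \<Rightarrow> complex" and \<theta> :: real
  assumes hol: "\<And>n. f n holomorphic_on {s. Re s > \<theta>}"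
    and bound: "\<And>\<sigma> r. \<sigma> > \<theta> \<Longrightarrow>
      \<exists>M. summable M \<and> (\<forall>n s. Re s \<ge> \<sigma> \<longrightarrow> norm s \<le> r \<longrightarrow> norm (f n s) \<le> M n)"
  shows "(\<lambda>s. \<Sum>n. f n s) holomorphic_on {s. Re s > \<theta>}"
proof (rule holomorphic_uniform_sequence)
  show "open {s. Re s > \<theta>}"
    by (rule open_halfspace_Re_gt)
  show "(\<lambda>s. \<Sum>n<N. f n s) holomorphic_on {s. Re s > \<theta>}" for N
    by (intro holomorphic_intros hol)
  fix s assume "s \<in> {s. Re s > \<theta>}"
  hence s: "Re s > \<theta>" by simp
  \<comment> \<open>Half the distance to the boundary keeps the closed disc inside the half-plane.
    The disc is bounded, so a majorant depending on the size of \<open>s\<close> is enough; Abel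
    summation produces terms that grow with \<open>norm s\<close>.\<close>
  define d where "d = (Re s - \<theta>) / 2"
  have d: "d > 0" using s by (simp add: d_def)
  have *: "Re z \<ge> Re s - d \<and> norm z \<le> norm s + d" if "z \<in> cball s d" for z
  proof -
    have "norm (s - z) \<le> d" using that by (simp add: dist_norm)
    moreover have "Re (s - z) \<le> norm (s - z)" by (rule complex_Re_le_cmod)
    moreover have "norm z \<le> norm s + norm (s - z)"
      by (metis add.commute norm_minus_commute norm_triangle_sub)
    ultimately show ?thesis by simp
  qed
  have gt: "Re s - d > \<theta>" using s by (simp add: d_def field_simps)
  obtain M where M: "summable M" "\<And>n z. Re z \<ge> Re s - d \<Longrightarrow> norm z \<le> norm s + d \<Longrightarrow> norm (f n z) \<le> M n"
    using bound[OF gt, of "norm s + d"] by auto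
  show "\<exists>d>0. cball s d \<subseteq> {s. \<theta> < Re s} \<and>
          uniform_limit (cball s d) (\<lambda>N s. \<Sum>n<N. f n s) (\<lambda>s. \<Sum>n. f n s) sequentially"
  proof (intro exI conjI)
    show "cball s d \<subseteq> {s. \<theta> < Re s}" using * gt by force
    show "uniform_limit (cball s d) (\<lambda>N s. \<Sum>n<N. f n s) (\<lambda>s. \<Sum>n. f n s) sequentially"
      by (rule Weierstrass_m_test[OF _ M(1)]) (use * M(2) in blast)
  qed (use d in auto)
qed

text \<open>Mean value bound for \<open>z powr -s\<close>. The condition
  \<open>Re s \<ge> -1\<close> makes the modulus of the derivative non-increasing along the segment,
  so the left end governs. This is the origin of \<open>\<theta> \<ge> -1\<close> in
  \<open>abel_summation\<close>.\<close>

lemma norm_powr_diff_le: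
  fixes s :: complex
  assumes "Re s \<ge> -1" "n > 0"
  shows "norm (of_nat n powr -s - of_nat (Suc n) powr -s) \<le> norm s * real n powr (- Re s - 1)"
proof -
  have "norm (of_nat n powr -s - of_nat (Suc n) powr -s)
      \<le> norm s * real n powr (- Re s - 1) * norm (of_nat n - of_nat (Suc n) :: complex)"
  proof (rule field_differentiable_bound)
    show "convex (closed_segment (of_nat n) (of_nat (Suc n) :: complex))" by (rule convex_closed_segment)
    fix z :: complex assume z: "z \<in> closed_segment (of_nat n) (of_nat (Suc n))"
    have "z \<in> closed_segment (of_real (real n)) (of_real (real (Suc n)))" using z by simp
    then obtain x where x: "z = of_real x" "x \<ge> real n"
      unfolding closed_segment_of_real by (auto simp: closed_segment_eq_real_ivl)
    have x0: "x > 0" using x assms by simp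
    show "((\<lambda>z. z powr -s) has_field_derivative (-s) * z powr (-s - 1))
      (at z within closed_segment (of_nat n) (of_nat (Suc n)))"
      by (rule has_field_derivative_powr[THEN DERIV_subset]) (use x x0 in auto)
    show "norm (-s * z powr (- s - 1)) \<le> norm s * real n powr (- Re s - 1)"
      using x x0 assms
      by (auto simp: norm_mult norm_powr_real_powr intro!: mult_left_mono powr_mono2')
  qed auto
  also have "norm (of_nat n - of_nat (Suc n) :: complex) = 1"
    by simp
  finally show ?thesis by simp
qed

lemma summable_Suc_powr: "summable (\<lambda>n. real (Suc n) powr a)" if "a < -1"
  using summable_real_powr_iff[of a] that summable_Suc_iff[of "\<lambda>n. real n powr a"] by simp

text \<open>
  If \<open>E\<close> is, up to an additive constant, the sequence of partial sums of \<open>b\<close>, this series is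
  \<open>\<Sum> b(n) n\<^sup>-\<^sup>s + E(0)\<close>.  Allowing the constant makes negative growth exponents \<open>\<theta>\<close> meaningful:
  take \<open>E\<close> to be the partial sums minus their limit.
\<close>
definition abel_series :: "(nat \<Rightarrow> complex) \<Rightarrow> complex \<Rightarrow> complex" where
  "abel_series E s =
     (\<Sum>n. E (Suc n) * (of_nat (Suc n) powr -s - of_nat (Suc (Suc n)) powr -s))"

text \<open>The bound starts at index 1: since \<open>0 powr \<theta> = 0\<close>, a bound at index
  0 would force \<open>E 0 = 0\<close> and exclude the additive constant.\<close>

locale abel_summation =
  fixes E :: "nat \<Rightarrow> complex" and C \<theta> :: real
  assumes E_bound: "\<And>n. norm (E (Suc n)) \<le> C * real (Suc n) powr \<theta>"
    and theta: "\<theta> \<ge> -1"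
begin

lemma C_nonneg: "C \<ge> 0"
proof -
  have "norm (E 1) \<le> C" using E_bound[of 0] by simp
  thus ?thesis using norm_ge_zero[of "E 1"] by linarith
qed

lemma term_bound:
  assumes "Re s \<ge> \<sigma>" "\<sigma> > \<theta>"
  shows "norm (E (Suc n) * (of_nat (Suc n) powr -s - of_nat (Suc (Suc n)) powr -s))
     \<le> norm s * (C * real (Suc n) powr (\<theta> - \<sigma> - 1))"
proof -
  have "norm (E (Suc n) * (of_nat (Suc n) powr -s - of_nat (Suc (Suc n)) powr -s))
     \<le> (C * real (Suc n) powr \<theta>) * (norm s * real (Suc n) powr (- Re s - 1))"
    unfolding norm_mult
    by (intro mult_mono E_bound norm_powr_diff_le) (use C_nonneg assms theta in auto)
  also have "\<dots> \<le> (C * real (Suc n) powr \<theta>) * (norm s * real (Suc n) powr (- \<sigma> - 1))"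
    by (intro mult_left_mono powr_mono) (use C_nonneg assms in auto)
  also have "\<dots> = norm s * (C * (real (Suc n) powr \<theta> * real (Suc n) powr (- \<sigma> - 1)))" by simp
  also have "real (Suc n) powr \<theta> * real (Suc n) powr (- \<sigma> - 1) = real (Suc n) powr (\<theta> - \<sigma> - 1)"
    by (subst powr_add[symmetric]) (simp add: algebra_simps)
  finally show ?thesis .
qed

lemma summable_bound: "\<sigma> > \<theta> \<Longrightarrow> summable (\<lambda>n. C * real (Suc n) powr (\<theta> - \<sigma> - 1))"
  by (intro summable_mult summable_Suc_powr) auto

lemma summable_norm_term:
  assumes "Re s > \<theta>"
  shows "summable (\<lambda>n. norm (E (Suc n) * (of_nat (Suc n) powr -s - of_nat (Suc (Suc n)) powr -s)))"
  by (rule summable_comparison_test'[OF summable_mult[OF summable_bound[OF assms], of "norm s"], of 0])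
     (use term_bound[OF order_refl assms] in auto)

lemma holomorphic: "abel_series E holomorphic_on {s. Re s > \<theta>}"
  unfolding abel_series_def[abs_def]
proof (rule holomorphic_suminf_halfplane)
  fix \<sigma> r :: real assume s: "\<sigma> > \<theta>"
  show "\<exists>M. summable M \<and> (\<forall>n s. \<sigma> \<le> Re s \<longrightarrow> cmod s \<le> r \<longrightarrow>
      cmod (E (Suc n) * (of_nat (Suc n) powr - s - of_nat (Suc (Suc n)) powr - s)) \<le> M n)"
  proof (intro exI conjI allI impI)
    show "summable (\<lambda>n. r * (C * real (Suc n) powr (\<theta> - \<sigma> - 1)))"
      by (intro summable_mult summable_bound s)
    fix n :: nat and z :: complex assume z: "\<sigma> \<le> Re z" "norm z \<le> r"
    show "cmod (E (Suc n) * (of_nat (Suc n) powr - z - of_nat (Suc (Suc n)) powr - z))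
      \<le> r * (C * real (Suc n) powr (\<theta> - \<sigma> - 1))"
      by (rule order_trans[OF term_bound[OF z(1) s]] mult_right_mono)+
         (use z C_nonneg in auto)
  qed
qed (intro holomorphic_intros; simp)

lemma linear_bound:
  assumes "\<sigma> > \<theta>"
  obtains K where "K \<ge> 0" "\<And>s. Re s \<ge> \<sigma> \<Longrightarrow> norm (abel_series E s) \<le> K * norm s"
proof
  let ?K = "\<Sum>n. C * real (Suc n) powr (\<theta> - \<sigma> - 1)"
  show "?K \<ge> 0"
    by (intro suminf_nonneg summable_bound assms) (use C_nonneg in auto)
  fix s assume s: "Re s \<ge> \<sigma>"
  have "norm (abel_series E s) \<le> (\<Sum>n. norm s * (C * real (Suc n) powr (\<theta> - \<sigma> - 1)))"
    unfolding abel_series_def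
    by (rule norm_suminf_le[OF term_bound[OF s assms] summable_mult[OF summable_bound[OF assms]]])
  also have "\<dots> = ?K * norm s"
    by (subst suminf_mult[OF summable_bound[OF assms]]) simp
  finally show "norm (abel_series E s) \<le> ?K * norm s" .
qed

lemma sums:
  assumes b: "\<And>n. E (Suc n) = E n + b (Suc n)" and s: "Re s > \<theta>"
  shows "(\<lambda>n. b (Suc n) * of_nat (Suc n) powr -s) sums (abel_series E s - E 0)"
proof -
  let ?p = "\<lambda>n. of_nat (Suc n) powr -s"
  let ?t = "\<lambda>n. E (Suc n) * (?p n - ?p (Suc n))"
  have part: "(\<Sum>n<N. b (Suc n) * ?p n) = (\<Sum>n<N. ?t n) - E 0 + E N * ?p N" for N
    by (induction N) (auto simp: b algebra_simps)
  have lim1: "(\<lambda>N. \<Sum>n<N. ?t n) \<longlonglongrightarrow> abel_series E s"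
    unfolding abel_series_def
    by (rule summable_LIMSEQ) (rule summable_norm_cancel[OF summable_norm_term[OF s]])
  have lim2: "(\<lambda>N. E N * ?p N) \<longlonglongrightarrow> 0"
  proof (rule LIMSEQ_imp_Suc, rule Lim_null_comparison)
    show "\<forall>\<^sub>F N in sequentially. norm (E (Suc N) * ?p (Suc N)) \<le> C * 2 * real (Suc N) powr (\<theta> - Re s)"
    proof (rule always_eventually, rule allI)
      fix N
      have "norm (?p (Suc N)) = real (Suc (Suc N)) powr (- Re s)"
        by (subst norm_powr_real_powr) auto
      \<comment> \<open>The base is \<open>N + 2\<close>, while \<open>E\<close> is bounded by a
        power of \<open>N + 1\<close>. For negative \<open>Re s\<close> the quotient of the bases is
        at most 2 and the exponent \<open>- Re s\<close> is below 1.\<close>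
      also have "\<dots> \<le> 2 * real (Suc N) powr (- Re s)"
      proof (cases "Re s \<ge> 0")
        case True
        have "real (Suc (Suc N)) powr (- Re s) \<le> 1 * real (Suc N) powr (- Re s)"
          using True by (simp add: powr_mono2')
        also have "\<dots> \<le> 2 * real (Suc N) powr (- Re s)" by (intro mult_right_mono) auto
        finally show ?thesis .
      next
        case False
        have "real (Suc (Suc N)) powr (- Re s) \<le> (2 * real (Suc N)) powr (- Re s)"
          using False by (intro powr_mono2) auto
        also have "\<dots> = 2 powr (- Re s) * real (Suc N) powr (- Re s)"
          by (rule powr_mult)
        also have "\<dots> \<le> 2 powr 1 * real (Suc N) powr (- Re s)"
          using s theta by (intro mult_right_mono powr_mono) auto
        finally show ?thesis by simp
      qed
      finally have "norm (E (Suc N) * ?p (Suc N)) \<le>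
          (C * real (Suc N) powr \<theta>) * (2 * real (Suc N) powr (- Re s))"
        unfolding norm_mult using E_bound[of N] C_nonneg by (intro mult_mono) auto
      also have "\<dots> = C * 2 * (real (Suc N) powr \<theta> * real (Suc N) powr (- Re s))" by simp
      also have "real (Suc N) powr \<theta> * real (Suc N) powr (- Re s) = real (Suc N) powr (\<theta> - Re s)"
        by (subst powr_add[symmetric]) simp
      finally show "norm (E (Suc N) * ?p (Suc N)) \<le> C * 2 * real (Suc N) powr (\<theta> - Re s)" .
    qed
    have "(\<lambda>N. real N powr (\<theta> - Re s)) \<longlonglongrightarrow> 0"
      using s by (intro tendsto_neg_powr filterlim_real_sequentially) auto
    hence "(\<lambda>N. real (Suc N) powr (\<theta> - Re s)) \<longlonglongrightarrow> 0" by (rule LIMSEQ_Suc)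
    from tendsto_mult_right[OF this, of "C*2"]
    show "(\<lambda>N. C * 2 * real (Suc N) powr (\<theta> - Re s)) \<longlonglongrightarrow> 0" by (simp add: mult.commute)
  qed
  show ?thesis
    unfolding sums_def part using tendsto_add[OF tendsto_diff[OF lim1 tendsto_const] lim2] by simp
qed

end

section \<open>Euler products\<close>

text \<open>Multiplying by 1 - f p deletes the multiples of p from the sum.\<close>
lemma infsum_times_prod_one_minus:
  fixes f :: "nat \<Rightarrow> complex"
  assumes mult: "\<And>m n. f (m * n) = f m * f n"
    and summ: "summable (\<lambda>n. norm (f n))"
    and "finite A" "\<And>p. p \<in> A \<Longrightarrow> prime p"
  shows "infsum f UNIV * (\<Prod>p\<in>A. 1 - f p) = infsum f {n. \<forall>p\<in>A. \<not> p dvd n}"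
  using assms(3,4)
proof (induction A rule: finite_induct)
  case empty
  then show ?case by simp
next
  case (insert p A)
  define S where "S = {n. \<forall>r\<in>A. \<not> r dvd n}"
  have sU: "f summable_on B" for B
    using norm_summable_imp_summable_on[OF summ] summable_on_subset_banach by blast
  have p: "prime p" "p > 0" using insert.prems prime_gt_0_nat by auto
  have dvd_iff: "r dvd p * n \<longleftrightarrow> r dvd n" if "r \<in> A" for r n
  proof -
    have "prime r" "r \<noteq> p" using that insert by auto
    hence "\<not> r dvd p" using primes_dvd_imp_eq[of r p] p(1) by blast
    thus ?thesis using prime_dvd_mult_iff[OF \<open>prime r\<close>, of p n] by blast
  qed
  have S_iff: "p * n \<in> S \<longleftrightarrow> n \<in> S" for n
    unfolding S_def using dvd_iff by blast
  have img: "(\<lambda>n. p * n) ` S = {n\<in>S. p dvd n}"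
  proof (intro equalityI subsetI)
    fix n assume n: "n \<in> {n\<in>S. p dvd n}"
    then obtain m where m: "n = p * m" unfolding dvd_def by blast
    with n S_iff[of m] show "n \<in> (\<lambda>n. p * n) ` S" by blast
  next
    fix n assume "n \<in> (\<lambda>n. p * n) ` S"
    then obtain m where "n = p * m" "m \<in> S" by blast
    with S_iff[of m] show "n \<in> {n\<in>S. p dvd n}" by simp
  qed
  have "infsum f S = infsum f {n\<in>S. p dvd n} + infsum f {n\<in>S. \<not> p dvd n}"
    by (subst infsum_Un_disjoint[symmetric]) (auto intro!: sU arg_cong[where f = "infsum f"])
  also have "infsum f {n\<in>S. p dvd n} = infsum (\<lambda>n. f (p * n)) S"
    unfolding img[symmetric] by (subst infsum_reindex) (use p in \<open>auto simp: inj_on_def o_def\<close>)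
  also have "\<dots> = f p * infsum f S"
    by (simp add: mult infsum_cmult_right')
  finally have "infsum f S * (1 - f p) = infsum f {n\<in>S. \<not> p dvd n}"
    by algebra
  also have "{n\<in>S. \<not> p dvd n} = {n. \<forall>r\<in>insert p A. \<not> r dvd n}"
    by (auto simp: S_def)
  finally have step: "infsum f S * (1 - f p) = infsum f {n. \<forall>r\<in>insert p A. \<not> r dvd n}" .
  have "infsum f UNIV * (\<Prod>r\<in>insert p A. 1 - f r) = infsum f UNIV * (\<Prod>r\<in>A. 1 - f r) * (1 - f p)"
    using insert.hyps by simp
  also have "infsum f UNIV * (\<Prod>r\<in>A. 1 - f r) = infsum f S"
    unfolding S_def using insert.IH insert.prems by blast
  finally show ?case using step by metis
qed

text \<open>After sieving by the primes up to \<open>N\<close>, only 1 and numbers above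
  \<open>N\<close> survive, so the error is at most a tail of an absolutely convergent series.
  Keeping the factors \<open>1 - f p\<close> beside the series avoids division.\<close>

lemma euler_product_tendsto:
  fixes f :: "nat \<Rightarrow> complex"
  assumes mult: "\<And>m n. f (m * n) = f m * f n" and f1: "f 1 = 1"
    and summ: "summable (\<lambda>n. norm (f n))"
  shows "(\<lambda>N. (\<Sum>n. f n) * (\<Prod>p | prime p \<and> p \<le> N. 1 - f p)) \<longlonglongrightarrow> 1"
proof -
  have sU: "f summable_on B" for B
    using norm_summable_imp_summable_on[OF summ] summable_on_subset_banach by blast
  have sN: "(\<lambda>n. norm (f n)) summable_on B" for B
    using summ summable_on_UNIV_nonneg_real_iff[of "\<lambda>n. norm (f n)"] summable_on_subset_banach by auto
  have tot: "(\<Sum>n. f n) = infsum f UNIV"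
    using has_sum_imp_sums[OF has_sum_infsum[OF sU[of UNIV]]] by (simp add: sums_iff)
  have totN: "infsum (\<lambda>n. norm (f n)) UNIV = (\<Sum>n. norm (f n))"
    using has_sum_imp_sums[OF has_sum_infsum[OF sN[of UNIV]]] by (simp add: sums_iff)
  show ?thesis
  proof (rule LIM_zero_cancel, rule Lim_null_comparison)
    show "\<forall>\<^sub>F N in sequentially. norm ((\<Sum>n. f n) * (\<Prod>p | prime p \<and> p \<le> N. 1 - f p) - 1)
      \<le> (\<Sum>n. norm (f n)) - (\<Sum>n<Suc N. norm (f n))"
    proof (rule eventually_mono[OF eventually_ge_at_top[of 2]])
      fix N :: nat assume N: "N \<ge> 2"
      define S where "S = {n. \<forall>p\<in>{p. prime p \<and> p \<le> N}. \<not> p dvd n}"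
      have S1: "1 \<in> S" by (auto simp: S_def)
      have sub: "S - {1} \<subseteq> {Suc N..}"
      proof
        fix n assume n: "n \<in> S - {1}"
        \<comment> \<open>The reason for \<open>N \<ge> 2\<close>: the prime 2 then removes 0, which
          the sum over all naturals contains.\<close>
        have "\<not> 2 dvd n" using n N two_is_prime_nat unfolding S_def by blast
        hence "n \<noteq> 0" by (intro notI) simp
        moreover obtain p where p: "prime p" "p dvd n"
          using n prime_factor_nat[of n] by auto
        ultimately show "n \<in> {Suc N..}" using n dvd_imp_le[OF p(2)] by (force simp: S_def)
      qed
      have "(\<Sum>n. f n) * (\<Prod>p | prime p \<and> p \<le> N. 1 - f p) = infsum f S"
        unfolding tot S_def by (rule infsum_times_prod_one_minus[OF mult summ]) auto
      also have "S = insert 1 (S - {1})" using S1 by auto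
      also have "infsum f \<dots> = 1 + infsum f (S - {1})"
        using f1 by (subst infsum_insert) (auto intro: sU)
      finally have "norm ((\<Sum>n. f n) * (\<Prod>p | prime p \<and> p \<le> N. 1 - f p) - 1)
          = norm (infsum f (S - {1}))" by simp
      also have "\<dots> \<le> infsum (\<lambda>n. norm (f n)) (S - {1})"
        by (rule norm_infsum_bound) (rule sN)
      also have "\<dots> \<le> infsum (\<lambda>n. norm (f n)) {Suc N..}"
        by (rule infsum_mono2) (use sub sN in auto)
      also have "\<dots> = infsum (\<lambda>n. norm (f n)) UNIV - infsum (\<lambda>n. norm (f n)) {..<Suc N}"
      proof -
        have "UNIV = {..<Suc N} \<union> {Suc N..}" "{..<Suc N} \<inter> {Suc N..} = {}" by auto
        thus ?thesis using infsum_Un_disjoint[of "\<lambda>n. norm (f n)" "{..<Suc N}" "{Suc N..}"] sN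
          by simp
      qed
      finally show "norm ((\<Sum>n. f n) * (\<Prod>p | prime p \<and> p \<le> N. 1 - f p) - 1)
          \<le> (\<Sum>n. norm (f n)) - (\<Sum>n<Suc N. norm (f n))" by (simp add: totN)
    qed
    have "(\<lambda>N. (\<Sum>n. norm (f n)) - (\<Sum>n<N. norm (f n))) \<longlonglongrightarrow> (\<Sum>n. norm (f n)) - (\<Sum>n. norm (f n))"
      by (intro tendsto_intros summable_LIMSEQ summ)
    from LIMSEQ_Suc[OF this]
    show "(\<lambda>N. (\<Sum>n. norm (f n)) - (\<Sum>n<Suc N. norm (f n))) \<longlonglongrightarrow> 0" by simp
  qed
qed

section \<open>The Borel--Caratheodory inequality\<close>

lemma borel_caratheodory:
  fixes f :: "complex \<Rightarrow> complex"
  assumes hol: "f holomorphic_on ball c R" and R: "0 < r" "r < R"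
    and A: "\<And>z. z \<in> ball c R \<Longrightarrow> Re (f z - f c) < A"
    and z: "z \<in> cball c r"
  shows "norm (f z - f c) \<le> 2 * A * r / (R - r)"
proof -
  define g where "g w = f (c + of_real R * w) - f c" for w
  have in_ball: "c + of_real R * w \<in> ball c R" if "norm w < 1" for w :: complex
    using that R by (simp add: dist_norm norm_mult)
  have holg: "g holomorphic_on ball 0 1"
    unfolding g_def
    by (intro holomorphic_intros holomorphic_on_compose_gen[OF _ hol, unfolded o_def])
       (use in_ball in auto)
  have reg: "Re (g w) < A" if "norm w < 1" for w
    unfolding g_def by (rule A[OF in_ball[OF that]])
  have A0: "A > 0" using reg[of 0] by (simp add: g_def)
  have nz: "2 * of_real A - g w \<noteq> 0" if "norm w < 1" for w
    using reg[OF that] A0 by (auto simp: complex_eq_iff)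
  txt \<open>This maps the half-plane \<open>Re u < A\<close>, in which \<open>g\<close> takes its values, to the unit disc.\<close>
  define h where "h w = g w / (2 * of_real A - g w)" for w
  \<comment> \<open>A number with real part below \<open>A\<close> is closer to 0 than to
    \<open>2 * A\<close>, the mirror image of 0 in the line of real part \<open>A\<close>.\<close>
  have lt: "norm (g w) < norm (2 * of_real A - g w)" if "norm w < 1" for w
  proof -
    have "norm (g w) ^ 2 < norm (2 * of_real A - g w) ^ 2"
      using reg[OF that] A0 unfolding cmod_power2
      by (simp add: power2_eq_square algebra_simps)
    thus ?thesis by (rule power_less_imp_less_base) simp
  qed
  define w where "w = (z - c) / of_real R"
  have w: "norm w \<le> r / R"
    using z R by (simp add: w_def norm_divide dist_norm norm_minus_commute divide_right_mono)
  have w1: "norm w < 1" using w R by (meson divide_less_eq_1_pos le_less_trans less_trans)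
  have "norm (h w) \<le> norm w"
  proof (rule Schwarz_Lemma(1)[OF _ _ _ w1])
    show "h holomorphic_on ball 0 1"
      unfolding h_def by (intro holomorphic_intros holg) (use nz in auto)
    show "h 0 = 0" by (simp add: h_def g_def)
    show "norm (h u) < 1" if "norm u < 1" for u
      using lt[OF that] nz[OF that] by (simp add: h_def norm_divide)
  qed
  also note w
  finally have hw: "norm (h w) \<le> r / R" .
  have "g w = h w * (2 * of_real A - g w)" using nz[OF w1] by (simp add: h_def)
  hence "norm (g w) = norm (h w) * norm (2 * of_real A - g w)" by (metis norm_mult)
  also have "\<dots> \<le> r / R * (2 * A + norm (g w))"
    using A0 R norm_triangle_ineq4[of "2 * of_real A" "g w"]
    by (intro mult_mono hw) (auto simp: norm_mult)
  \<comment> \<open>\<open>norm (g w)\<close> occurred on both sides; solving for it produces the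
    denominator \<open>R - r\<close>.\<close>
  finally have "norm (g w) * (R - r) \<le> 2 * A * r"
    using R by (simp add: field_simps)
  hence "norm (g w) \<le> 2 * A * r / (R - r)" using R by (simp add: field_simps)
  also have "g w = f z - f c" using R by (simp add: g_def w_def)
  finally show ?thesis .
qed

section \<open>Newman's contour argument\<close>

lemma powr_tail_term_le:
  fixes x :: real
  assumes "x > 0" "n \<ge> 1"
  shows "x * real (Suc n) powr (-x - 1) \<le> real n powr -x - real (Suc n) powr -x"
proof -
  \<comment> \<open>The mean value theorem stands in for the integral of
    \<open>x * t powr (-x - 1)\<close> from \<open>n\<close> to \<open>n + 1\<close>; the resulting
    differences telescope when summed.\<close>
  have "\<exists>z. real n < z \<and> z < real (Suc n) \<and>
      real (Suc n) powr -x - real n powr -x = (real (Suc n) - real n) * (-x * z powr (-x - 1))"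
    by (rule MVT2) (use assms in \<open>auto intro!: derivative_eq_intros simp: powr_diff\<close>)
  then obtain z where z: "real n < z" "z < real (Suc n)"
    "real (Suc n) powr -x - real n powr -x = -x * z powr (-x - 1)" by auto
  have "real (Suc n) powr (-x - 1) \<le> z powr (-x - 1)"
    using z assms by (intro powr_mono2') auto
  hence "x * real (Suc n) powr (-x - 1) \<le> x * z powr (-x - 1)" using assms by simp
  thus ?thesis using z by simp
qed

lemma powr_tail_sum_le:
  fixes x :: real
  assumes x: "x > 0" and N: "N \<ge> 1"
  shows "summable (\<lambda>n. real (n + Suc N) powr (-x - 1))"
    and "(\<Sum>n. real (n + Suc N) powr (-x - 1)) \<le> real N powr -x / x"
proof -
  show *: "summable (\<lambda>n. real (n + Suc N) powr (-x - 1))"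
    using summable_real_powr_iff[of "-x - 1"] x
      summable_iff_shift[of "\<lambda>n. real n powr (-x - 1)" "Suc N"] by simp
  have "(\<lambda>n. real n powr -x) \<longlonglongrightarrow> 0"
    using x by (intro tendsto_neg_powr filterlim_real_sequentially) auto
  from LIMSEQ_ignore_initial_segment[OF this, of N]
  have "(\<lambda>n. real (n + N) powr -x - real (Suc n + N) powr -x) sums (real (0 + N) powr -x - 0)"
    by (rule telescope_sums')
  hence S: "(\<lambda>n. (real (n + N) powr -x - real (Suc n + N) powr -x) / x) sums (real N powr -x / x)"
    using sums_divide by force
  have "(\<Sum>n. real (n + Suc N) powr (-x - 1))
      \<le> (\<Sum>n. (real (n + N) powr -x - real (Suc n + N) powr -x) / x)"
  proof (rule suminf_le[OF _ * sums_summable[OF S]])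
    fix n
    show "real (n + Suc N) powr (-x - 1) \<le> (real (n + N) powr -x - real (Suc n + N) powr -x) / x"
      using powr_tail_term_le[OF x, of "n + N"] x N by (simp add: field_simps)
  qed
  also have "\<dots> = real N powr -x / x" using S by (simp add: sums_iff)
  finally show "(\<Sum>n. real (n + Suc N) powr (-x - 1)) \<le> real N powr -x / x" .
qed

text \<open>The summand decreases, so each term is at most the increment of
  \<open>t powr a / a\<close> over the unit interval to its left, and the last term may be
  included.\<close>

lemma powr_sum_le_small:
  fixes a :: real
  assumes "0 < a" "a \<le> 1"
  shows "(\<Sum>n\<le>N. real n powr (a - 1)) \<le> real N powr a / a"
proof (induction N)
  case (Suc N)
  have "a * real (Suc N) powr (a - 1) \<le> real (Suc N) powr a - real N powr a"
  proof (cases "N = 0")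
    case False
    have "\<exists>z. real N < z \<and> z < real (Suc N) \<and>
        real (Suc N) powr a - real N powr a = (real (Suc N) - real N) * (a * z powr (a - 1))"
      by (rule MVT2) (use assms False in \<open>auto intro!: derivative_eq_intros simp: powr_diff\<close>)
    then obtain z where z: "real N < z" "z < real (Suc N)"
      "real (Suc N) powr a - real N powr a = a * z powr (a - 1)" by auto
    have "real (Suc N) powr (a - 1) \<le> z powr (a - 1)"
      using z assms by (intro powr_mono2') auto
    thus ?thesis using z assms by simp
  qed (use assms in auto)
  hence "real (Suc N) powr (a - 1) \<le> real (Suc N) powr a / a - real N powr a / a"
    using assms by (simp add: field_simps)
  thus ?case using Suc.IH by simp
qed (use assms in auto)

text \<open>For a non-decreasing summand the comparison is with the interval to the right of each
  term, so the sum stops before \<open>N\<close>.\<close>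

lemma powr_sum_le_large:
  fixes a :: real
  assumes "1 \<le> a"
  shows "(\<Sum>n<N. real n powr (a - 1)) \<le> real N powr a / a"
proof (induction N)
  case (Suc N)
  have "a * real N powr (a - 1) \<le> real (Suc N) powr a - real N powr a"
  proof (cases "N = 0")
    case False
    have "\<exists>z. real N < z \<and> z < real (Suc N) \<and>
        real (Suc N) powr a - real N powr a = (real (Suc N) - real N) * (a * z powr (a - 1))"
      by (rule MVT2) (use assms False in \<open>auto intro!: derivative_eq_intros simp: powr_diff\<close>)
    then obtain z where z: "real N < z" "z < real (Suc N)"
      "real (Suc N) powr a - real N powr a = a * z powr (a - 1)" by auto
    have "real N powr (a - 1) \<le> z powr (a - 1)"
      using z assms by (intro powr_mono2) auto
    thus ?thesis using z assms by simp
  qed (use assms in auto)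
  hence "real N powr (a - 1) \<le> real (Suc N) powr a / a - real N powr a / a"
    using assms by (simp add: field_simps)
  thus ?case using Suc.IH by simp
qed (use assms in auto)

text \<open>The condition \<open>a \<le> real N\<close> absorbs a missing last term into
  \<open>real N powr a / a\<close>, hence the factor 2. In Newman's argument \<open>a\<close> is
  \<open>- Re z\<close>, at most \<open>R\<close>, so the contour may not be larger than
  \<open>N\<close>.\<close>

lemma powr_sum_le:
  fixes a :: real
  assumes a: "0 < a" "a \<le> real N"
  shows "(\<Sum>n\<le>N. real n powr (a - 1)) \<le> 2 * real N powr a / a"
proof (cases "a \<le> 1")
  case True
  have "real N powr a / a \<le> 2 * real N powr a / a"
    using a by (intro divide_right_mono) auto
  with powr_sum_le_small[OF a(1) True, of N] show ?thesis by linarith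
next
  case False
  have "N > 0" using a by (cases N) auto
  have "real N powr (a - 1) * a \<le> real N powr (a - 1) * real N"
    using a by (intro mult_left_mono) auto
  also have "\<dots> = real N powr a"
    using \<open>N > 0\<close> by (simp add: powr_diff)
  finally have "real N powr (a - 1) \<le> real N powr a / a" using a by (simp add: field_simps)
  moreover have "(\<Sum>n\<le>N. real n powr (a - 1)) = (\<Sum>n<N. real n powr (a - 1)) + real N powr (a - 1)"
    by (simp add: lessThan_Suc_atMost[symmetric])
  ultimately show ?thesis using powr_sum_le_large[of a N] False by simp
qed

section \<open>The contour and the size of Newman's kernel on it\<close>

lemma contour_integral_rectangle:
  fixes \<phi> :: "complex \<Rightarrow> complex" and L R :: real
  assumes hol: "\<phi> holomorphic_on S" and S: "convex S" "open S"
    and sub: "{z. -L \<le> Re z \<and> Re z \<le> R \<and> \<bar>Im z\<bar> \<le> R} \<subseteq> S"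
    and LR: "L > 0" "R > 0"
  defines "I \<equiv> \<lambda>a b. contour_integral (linepath a b) (\<lambda>z. \<phi> z / z)"
  shows "2 * pi * \<i> * \<phi> 0 =
     (I (Complex 0 (-R)) (Complex R (-R)) + I (Complex R (-R)) (Complex R R)
        + I (Complex R R) (Complex 0 R)) +
     (I (Complex 0 R) (Complex (-L) R) + I (Complex (-L) R) (Complex (-L) (-R))
        + I (Complex (-L) (-R)) (Complex 0 (-R)))"
proof -
  let ?f = "\<lambda>z. \<phi> z / z"
  let ?p = "Complex (-L) (-R)" and ?q = "Complex R R"
  have box: "0 \<in> box ?p ?q" using LR by (simp add: in_box_complex_iff)
  have cbox: "cbox ?p ?q \<subseteq> S" using sub by (force simp: in_cbox_complex_iff abs_le_iff)
  have path: "path_image (rectpath ?p ?q) \<subseteq> S - {0}"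
    using path_image_rectpath_cbox_minus_box[of ?p ?q] LR cbox box by auto
  have "(?f has_contour_integral 2 * pi * \<i> * \<phi> 0) (rectpath ?p ?q)"
    using Cauchy_integral_formula_convex_simple[OF S(1) hol, of 0 "rectpath ?p ?q"] path cbox box
      winding_number_rectpath[OF box] S box_subset_cbox[of ?p ?q]
    by (auto simp: interior_open)
  moreover have cont: "continuous_on T ?f" if "T \<subseteq> S - {0}" for T
    using that holomorphic_on_imp_continuous_on[OF holomorphic_on_subset[OF hol, of T]]
    by (auto intro!: continuous_intros)
  have seg: "closed_segment ?p (Complex R (-R)) \<subseteq> S - {0}" "closed_segment (Complex R (-R)) ?q \<subseteq> S - {0}"
    "closed_segment ?q (Complex (-L) R) \<subseteq> S - {0}" "closed_segment (Complex (-L) R) ?p \<subseteq> S - {0}"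
    using path by (auto simp: rectpath_def Let_def path_image_join)
  have int: "?f contour_integrable_on linepath a b" if "closed_segment a b \<subseteq> S - {0}" for a b
    by (rule contour_integrable_continuous_linepath[OF cont[OF that]])
  have "contour_integral (rectpath ?p ?q) ?f =
     I ?p (Complex R (-R)) + (I (Complex R (-R)) ?q + (I ?q (Complex (-L) R) + I (Complex (-L) R) ?p))"
    unfolding rectpath_def Let_def I_def using seg int
    by (simp add: contour_integral_join valid_path_join contour_integrable_joinI)
  \<comment> \<open>The horizontal sides are cut at the imaginary axis: to its right the tail of the
    series is estimated, to its left the continuation and the partial sum separately.\<close>
  moreover have "I ?p (Complex R (-R)) = I ?p (Complex 0 (-R)) + I (Complex 0 (-R)) (Complex R (-R))"
    unfolding I_def
    by (rule contour_integral_split_linepath[OF cont[OF seg(1)]])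
       (use LR in \<open>simp add: closed_segment_same_Im closed_segment_eq_real_ivl\<close>)
  moreover have "I ?q (Complex (-L) R) = I ?q (Complex 0 R) + I (Complex 0 R) (Complex (-L) R)"
    unfolding I_def
    by (rule contour_integral_split_linepath[OF cont[OF seg(3)]])
       (use LR in \<open>simp add: closed_segment_same_Im closed_segment_eq_real_ivl\<close>)
  ultimately show ?thesis by (simp add: contour_integral_unique algebra_simps)
qed

text \<open>On these sides one factor of (z - iR)(z + iR) is the real number \<open>Re z\<close>,
  and the other has modulus at most \<open>3 * R\<close>. The factor |Re z| so gained will cancel a
  denominator \<open>Re z\<close>.\<close>

lemma newman_kernel_horizontal:
  fixes N :: nat and R :: real and z :: complex
  assumes N: "N \<ge> 1" and R: "R > 0" and z: "\<bar>Im z\<bar> = R" "\<bar>Re z\<bar> \<le> R"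
  shows "norm (of_nat N powr z * (z\<^sup>2 + of_real R ^ 2) / of_real R ^ 2 / z)
     \<le> real N powr Re z * (3 * \<bar>Re z\<bar> / R\<^sup>2)"
proof -
  have nz: "norm z \<ge> R" using abs_Im_le_cmod[of z] z by simp
  have fac: "norm (z\<^sup>2 + of_real R ^ 2) = norm (z - \<i> * of_real R) * norm (z + \<i> * of_real R)"
    by (subst norm_mult[symmetric]) (simp add: algebra_simps power2_eq_square)
  have "norm (z\<^sup>2 + of_real R ^ 2) \<le> \<bar>Re z\<bar> * (3 * R)"
  proof (cases "Im z = R")
    case True
    hence "z - \<i> * of_real R = of_real (Re z)" by (simp add: complex_eq_iff)
    hence "norm (z - \<i> * of_real R) = \<bar>Re z\<bar>" by (metis norm_of_real)
    moreover have "norm (z + \<i> * of_real R) \<le> 3 * R"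
      using cmod_le[of "z + \<i> * of_real R"] True z R by simp
    ultimately show ?thesis unfolding fac by (intro mult_mono) auto
  next
    case False
    hence "Im z = -R" using z by linarith
    hence "z + \<i> * of_real R = of_real (Re z)" by (simp add: complex_eq_iff)
    hence "norm (z + \<i> * of_real R) = \<bar>Re z\<bar>" by (metis norm_of_real)
    moreover have "norm (z - \<i> * of_real R) \<le> 3 * R"
      using cmod_le[of "z - \<i> * of_real R"] \<open>Im z = -R\<close> z R by simp
    ultimately show ?thesis unfolding fac mult.commute[of "norm (z - \<i> * of_real R)"]
      by (intro mult_mono) auto
  qed
  hence "norm (z\<^sup>2 + of_real R ^ 2) / R\<^sup>2 / norm z \<le> \<bar>Re z\<bar> * (3 * R) / R\<^sup>2 / R"
    using nz R by (intro frac_le divide_right_mono) auto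
  also have "\<dots> = 3 * \<bar>Re z\<bar> / R\<^sup>2" using R by (simp add: field_simps)
  finally have "real N powr Re z * (norm (z\<^sup>2 + of_real R ^ 2) / R\<^sup>2 / norm z)
      \<le> real N powr Re z * (3 * \<bar>Re z\<bar> / R\<^sup>2)" by (intro mult_left_mono) auto
  thus ?thesis using N by (simp add: norm_mult norm_divide norm_power norm_powr_real_powr)
qed

text \<open>Away from the imaginary axis no cancellation is required. The distance \<open>m\<close>
  is a parameter because the sides at \<open>R\<close>, \<open>-R\<close> and
  \<open>-\<delta>\<close> all use this bound.\<close>

lemma newman_kernel_vertical:
  fixes N :: nat and R :: real and z :: complex
  assumes N: "N \<ge> 1" and R: "R > 0" and z: "\<bar>Re z\<bar> \<le> R" "\<bar>Im z\<bar> \<le> R"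
    and m: "m > 0" "\<bar>Re z\<bar> = m"
  shows "norm (of_nat N powr z * (z\<^sup>2 + of_real R ^ 2) / of_real R ^ 2 / z)
     \<le> real N powr Re z * (3 / m)"
proof -
  have nz: "norm z \<ge> m" using abs_Re_le_cmod[of z] m by simp
  have "norm (z\<^sup>2 + of_real R ^ 2) \<le> norm z ^ 2 + R ^ 2"
    using norm_triangle_ineq[of "z^2" "of_real R ^ 2"] by (simp add: norm_power)
  also have "norm z ^ 2 = \<bar>Re z\<bar> ^ 2 + \<bar>Im z\<bar> ^ 2" by (simp add: cmod_power2)
  also have "\<dots> + R^2 \<le> R^2 + R^2 + R^2"
    using z by (intro add_mono power_mono) auto
  finally have "norm (z\<^sup>2 + of_real R ^ 2) / R\<^sup>2 / norm z \<le> 3 * R^2 / R\<^sup>2 / m"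
    using nz R m by (intro frac_le divide_right_mono) auto
  also have "\<dots> = 3 / m" using R by simp
  finally have "real N powr Re z * (norm (z\<^sup>2 + of_real R ^ 2) / R\<^sup>2 / norm z)
      \<le> real N powr Re z * (3 / m)" by (intro mult_left_mono) auto
  thus ?thesis using N by (simp add: norm_mult norm_divide norm_power norm_powr_real_powr)
qed

text \<open>
  Cauchy's formula for \<open>G(z) N\<^sup>z (z\<^sup>2 + R\<^sup>2) / (R\<^sup>2 z)\<close> is used on the rectangle with real part from
  \<open>-\<delta>\<close> to \<open>R\<close>, and for the entire partial sum in place of \<open>G\<close> on the square of half-side \<open>R\<close>.  The
  factor \<open>z\<^sup>2 + R\<^sup>2\<close> cancels the blow-up of the bounds for tail and partial sum at \<open>\<plusminus>iR\<close>.  The terms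
  with \<open>n = 0\<close> vanish because \<open>0 powr s = 0\<close>.
\<close>
lemma newman_estimate:
  fixes a :: "nat \<Rightarrow> complex" and G :: "complex \<Rightarrow> complex" and \<delta> \<delta>' C R :: real
  assumes a: "\<And>n. norm (a n) \<le> 1"
    and hol: "G holomorphic_on {z. Re z > -\<delta>'}"
    and series: "\<And>z. Re z > 0 \<Longrightarrow> G z = (\<Sum>n. a n * of_nat n powr -(1 + z))"
    and \<delta>: "0 < \<delta>" "\<delta> < \<delta>'" "\<delta> \<le> 1"
    and C: "C \<ge> 0" "\<And>z. -\<delta> \<le> Re z \<Longrightarrow> Re z \<le> 0 \<Longrightarrow> norm (G z) \<le> C * (1 + \<bar>Im z\<bar>)"
    and R: "1 \<le> R" "R \<le> real N"
  shows "norm (G 0 - (\<Sum>n\<le>N. a n * of_nat n powr -1))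
     \<le> (36 + 12 * C) / R + 12 * C / \<delta> * (R\<^sup>2 * real N powr -\<delta>)"
proof -
  define GN where "GN z = (\<Sum>n\<le>N. a n * of_nat n powr -(1 + z))" for z
  define W where "W z = of_nat N powr z * (z\<^sup>2 + of_real R ^ 2) / of_real R ^ 2" for z :: complex
  have N: "N \<ge> 1" using R by linarith
  have term_le: "norm (a n * of_nat n powr -(1 + z)) \<le> real n powr (- Re z - 1)" for n z
  proof -
    have "norm (a n * of_nat n powr -(1 + z)) \<le> 1 * real n powr (- Re z - 1)"
      unfolding norm_mult by (intro mult_mono a) (auto simp: norm_powr_real_powr minus_diff_commute)
    thus ?thesis by simp
  qed
  have tail: "norm (G z - GN z) \<le> real N powr - Re z / Re z" if z: "Re z > 0" for z
  proof -
    have sm: "summable (\<lambda>n. a n * of_nat n powr -(1 + z))"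
      by (rule summable_comparison_test'[of "\<lambda>n. real n powr (- Re z - 1)" 0])
         (use z term_le in \<open>auto simp: summable_real_powr_iff\<close>)
    have "G z - GN z = (\<Sum>n. a (n + Suc N) * of_nat (n + Suc N) powr -(1 + z))"
      using suminf_split_initial_segment[OF sm, of "Suc N"] series[OF z]
      by (simp add: GN_def lessThan_Suc_atMost del: sum.lessThan_Suc)
    also have "norm \<dots> \<le> (\<Sum>n. real (n + Suc N) powr (- Re z - 1))"
      by (rule norm_suminf_le[OF term_le powr_tail_sum_le(1)[OF z N]])
    also have "\<dots> \<le> real N powr - Re z / Re z" by (rule powr_tail_sum_le(2)[OF z N])
    finally show ?thesis .
  qed
  have head: "norm (GN z) \<le> 2 * real N powr - Re z / - Re z" if "Re z < 0" "- Re z \<le> R" for z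
  proof -
    have "norm (GN z) \<le> (\<Sum>n\<le>N. real n powr (- Re z - 1))"
      unfolding GN_def by (rule sum_norm_le) (rule term_le)
    also have "\<dots> \<le> 2 * real N powr - Re z / - Re z"
      by (rule powr_sum_le) (use that R in auto)
    finally show ?thesis .
  qed
  have horiz: "norm (W z / z) \<le> real N powr Re z * (3 * \<bar>Re z\<bar> / R\<^sup>2)"
    if "\<bar>Im z\<bar> = R" "\<bar>Re z\<bar> \<le> R" for z
    unfolding W_def by (rule newman_kernel_horizontal) (use N R that in auto)
  have vert: "norm (W z / z) \<le> real N powr Re z * (3 / m)"
    if "\<bar>Re z\<bar> = m" "m \<le> R" "m > 0" "\<bar>Im z\<bar> \<le> R" for z m
    unfolding W_def by (rule newman_kernel_vertical) (use N R that in auto)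
  \<comment> \<open>The power of \<open>N\<close> in the kernel is inverse to the one in
    \<open>tail\<close> and in \<open>head\<close>, so the products below are bounded independently
    of \<open>N\<close>.\<close>
  have pow_cancel: "real N powr - x * real N powr x = 1" for x
    using N by (simp flip: powr_add)

  have right_h: "norm ((G z - GN z) * (W z / z)) \<le> 3 / R\<^sup>2"
    if "\<bar>Im z\<bar> = R" "0 \<le> Re z" "Re z \<le> R" for z
  proof (cases "Re z = 0")
    \<comment> \<open>At iR and -iR the bound \<open>tail\<close> does not apply, but the kernel
      vanishes.\<close>
    case True
    with horiz[of z] that have "norm (W z / z) \<le> 0" by simp
    hence "W z / z = 0" by (simp only: norm_le_zero_iff)
    thus ?thesis by (simp only: mult_zero_right norm_zero) simp
  next
    case False
    hence "norm ((G z - GN z) * (W z / z)) \<le>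
        (real N powr - Re z / Re z) * (real N powr Re z * (3 * \<bar>Re z\<bar> / R\<^sup>2))"
      unfolding norm_mult using that by (intro mult_mono tail horiz) auto
    also have "\<dots> = (real N powr - Re z * real N powr Re z) * (3 / R\<^sup>2)"
      using False that by simp
    finally show ?thesis unfolding pow_cancel by simp
  qed
  have right_v: "norm ((G z - GN z) * (W z / z)) \<le> 3 / R\<^sup>2" if "Re z = R" "\<bar>Im z\<bar> \<le> R" for z
  proof -
    have "norm ((G z - GN z) * (W z / z)) \<le>
        (real N powr - Re z / Re z) * (real N powr Re z * (3 / R))"
      unfolding norm_mult using that R by (intro mult_mono tail vert) auto
    also have "\<dots> = (real N powr - Re z * real N powr Re z) * (3 / R\<^sup>2)"
      using that by (simp add: power2_eq_square)
    finally show ?thesis unfolding pow_cancel by simp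
  qed
  have leftN_h: "norm (GN z * (W z / z)) \<le> 6 / R\<^sup>2"
    if "\<bar>Im z\<bar> = R" "Re z \<le> 0" "- Re z \<le> R" for z
  proof (cases "Re z = 0")
    case True
    with horiz[of z] that have "norm (W z / z) \<le> 0" by simp
    hence "W z / z = 0" by (simp only: norm_le_zero_iff)
    thus ?thesis by (simp only: mult_zero_right norm_zero) simp
  next
    case False
    hence "norm (GN z * (W z / z)) \<le>
        (2 * real N powr - Re z / - Re z) * (real N powr Re z * (3 * \<bar>Re z\<bar> / R\<^sup>2))"
      unfolding norm_mult using that by (intro mult_mono head horiz) (auto simp: divide_le_0_iff)
    also have "\<dots> = (real N powr - Re z * real N powr Re z) * (6 / R\<^sup>2)"
      using False that by simp
    finally show ?thesis unfolding pow_cancel by simp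
  qed
  \<comment> \<open>Going as far left as \<open>-R\<close> matters: at \<open>-\<delta>\<close> the
    same two bounds would give 6/\<delta>^2 on a side of length \<open>2 * R\<close>, which is not
    small.\<close>
  have leftN_v: "norm (GN z * (W z / z)) \<le> 6 / R\<^sup>2" if "Re z = -R" "\<bar>Im z\<bar> \<le> R" for z
  proof -
    have "norm (GN z * (W z / z)) \<le>
        (2 * real N powr - Re z / - Re z) * (real N powr Re z * (3 / R))"
      unfolding norm_mult using that R by (intro mult_mono head vert) auto
    also have "\<dots> = (real N powr - Re z * real N powr Re z) * (6 / R\<^sup>2)"
      using that by (simp add: power2_eq_square)
    finally show ?thesis unfolding pow_cancel by simp
  qed
  have Nle1: "real N powr x \<le> 1" if "x \<le> 0" for x
    using powr_mono[of x 0 "real N"] that N by simp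
  \<comment> \<open>No decay in \<open>N\<close> is available near the imaginary axis. The growth of
    \<open>G\<close> consumes one of the two factors 1/R of the kernel, and the other
    remains.\<close>
  have leftG_h: "norm (G z * (W z / z)) \<le> 6 * C / R"
    if "\<bar>Im z\<bar> = R" "Re z \<le> 0" "- Re z \<le> \<delta>" for z
  proof -
    have "norm (W z / z) \<le> real N powr Re z * (3 * \<bar>Re z\<bar> / R\<^sup>2)"
      by (rule horiz) (use that \<delta> R in auto)
    also have "\<dots> \<le> 1 * (3 * 1 / R\<^sup>2)"
      using that \<delta> by (intro mult_mono Nle1 divide_right_mono) (auto simp: divide_le_0_iff)
    finally have "norm (G z * (W z / z)) \<le> (C * (1 + \<bar>Im z\<bar>)) * (3 / R\<^sup>2)"
      unfolding norm_mult using that C by (intro mult_mono C) auto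
    also have "\<dots> \<le> (C * (R + R)) * (3 / R\<^sup>2)"
      using that C R by (intro mult_right_mono mult_left_mono) auto
    also have "\<dots> = 6 * C / R" using R by (simp add: power2_eq_square)
    finally show ?thesis .
  qed
  have leftG_v: "norm (G z * (W z / z)) \<le> 6 * C / \<delta> * (R * real N powr -\<delta>)"
    if "Re z = -\<delta>" "\<bar>Im z\<bar> \<le> R" for z
  proof -
    have "norm (G z * (W z / z)) \<le> (C * (1 + \<bar>Im z\<bar>)) * (real N powr Re z * (3 / \<delta>))"
      unfolding norm_mult using that C \<delta> R by (intro mult_mono C vert) auto
    also have "\<dots> \<le> (C * (R + R)) * (real N powr Re z * (3 / \<delta>))"
      using that C R \<delta> by (intro mult_right_mono mult_left_mono) auto
    also have "\<dots> = 6 * C / \<delta> * (R * real N powr -\<delta>)" using that by simp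
    finally show ?thesis .
  qed

  have holW: "W holomorphic_on S" for S
    unfolding W_def using R N by (intro holomorphic_intros) auto
  have holGN: "GN holomorphic_on S" for S
    unfolding GN_def
  proof (rule holomorphic_on_sum)
    fix n
    show "(\<lambda>z. a n * of_nat n powr - (1 + z)) holomorphic_on S"
      by (cases "n = 0") (auto intro!: holomorphic_intros)
  qed
  have W0: "W 0 = 1" using R N by (simp add: W_def)
  define I where "I f u v = contour_integral (linepath u v) (\<lambda>z. f z * W z / z)"
    for f :: "complex \<Rightarrow> complex" and u v
  have eqG: "2 * pi * \<i> * G 0 =
     (I G (Complex 0 (-R)) (Complex R (-R)) + I G (Complex R (-R)) (Complex R R)
        + I G (Complex R R) (Complex 0 R)) +
     (I G (Complex 0 R) (Complex (-\<delta>) R) + I G (Complex (-\<delta>) R) (Complex (-\<delta>) (-R))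
        + I G (Complex (-\<delta>) (-R)) (Complex 0 (-R)))"
    using contour_integral_rectangle[OF holomorphic_on_mult[OF hol holW] convex_halfspace_Re_gt
        open_halfspace_Re_gt, of \<delta> R] \<delta> R W0
    by (fastforce simp: I_def)
  have eqN: "2 * pi * \<i> * GN 0 =
     (I GN (Complex 0 (-R)) (Complex R (-R)) + I GN (Complex R (-R)) (Complex R R)
        + I GN (Complex R R) (Complex 0 R)) +
     (I GN (Complex 0 R) (Complex (-R) R) + I GN (Complex (-R) R) (Complex (-R) (-R))
        + I GN (Complex (-R) (-R)) (Complex 0 (-R)))"
    using contour_integral_rectangle[OF holomorphic_on_mult[OF holGN holW] convex_UNIV open_UNIV, of R R]
      R W0 by (simp add: I_def)
  have integrable: "(\<lambda>z. f z * W z / z) contour_integrable_on linepath u v"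
    if "f holomorphic_on closed_segment u v" "0 \<notin> closed_segment u v" for f u v
    by (intro contour_integrable_continuous_linepath holomorphic_on_imp_continuous_on
          holomorphic_intros that holW) (use that in auto)
  have bound: "norm (I f u v) \<le> B * d"
    if "f holomorphic_on closed_segment u v" "0 \<notin> closed_segment u v" "B \<ge> 0"
      "\<And>z. z \<in> closed_segment u v \<Longrightarrow> norm (f z * (W z / z)) \<le> B" "norm (v - u) = d" for f u v B d
    unfolding I_def using contour_integral_bound_linepath[OF integrable[OF that(1,2)] that(3)] that(4,5)
    by simp
  have hG: "G holomorphic_on closed_segment u v" if "closed_segment u v \<subseteq> {z. Re z > -\<delta>'}" for u v
    by (rule holomorphic_on_subset[OF hol that])
  have boundN: "norm (I GN u v) \<le> B * d"
    if "0 \<notin> closed_segment u v" "B \<ge> 0"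
      "\<And>z. z \<in> closed_segment u v \<Longrightarrow> norm (GN z * (W z / z)) \<le> B" "norm (v - u) = d" for u v B d
    by (rule bound[OF holGN that])
  have boundG: "norm (I G u v) \<le> B * d"
    if "closed_segment u v \<subseteq> {z. Re z > -\<delta>'}" "0 \<notin> closed_segment u v" "B \<ge> 0"
      "\<And>z. z \<in> closed_segment u v \<Longrightarrow> norm (G z * (W z / z)) \<le> B" "norm (v - u) = d" for u v B d
    by (rule bound[OF hG[OF that(1)] that(2-)])
  have boundR: "norm (I G u v - I GN u v) \<le> B * d"
    if sub: "closed_segment u v \<subseteq> {z. Re z > -\<delta>'}" and 0: "0 \<notin> closed_segment u v" and B: "B \<ge> 0"
      "\<And>z. z \<in> closed_segment u v \<Longrightarrow> norm ((G z - GN z) * (W z / z)) \<le> B" "norm (v - u) = d"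
    for u v B d
  proof -
    have "I G u v - I GN u v = I (\<lambda>z. G z - GN z) u v"
      unfolding I_def
      by (subst contour_integral_diff[symmetric, OF integrable[OF hG[OF sub] 0] integrable[OF holGN 0]])
         (simp add: diff_divide_distrib left_diff_distrib)
    with bound[OF holomorphic_on_diff[OF hG[OF sub] holGN] 0 B] show ?thesis by simp
  qed
  note segs = closed_segment_same_Im closed_segment_same_Re closed_segment_eq_real_ivl
  have len: "norm (Complex x y - Complex x' y) = \<bar>x - x'\<bar>"
            "norm (Complex x y - Complex x y') = \<bar>y - y'\<bar>" for x x' y y'
    by (auto simp: cmod_def)
  \<comment> \<open>Pointwise bounds times the side lengths \<open>R\<close> and
    \<open>2 * R\<close>; read from right to left they match the form \<open>B * d\<close>.\<close>
  have R2: "3 / R\<^sup>2 * R = 3 / R" "3 / R\<^sup>2 * (2 * R) = 6 / R" "6 / R\<^sup>2 * R = 6 / R"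
    "6 / R\<^sup>2 * (2 * R) = 12 / R"
    using R by (simp_all add: power2_eq_square)
  have Rpos: "R > 0" using R by simp

  have b1: "norm (I G (Complex 0 (-R)) (Complex R (-R)) - I GN (Complex 0 (-R)) (Complex R (-R))) \<le> 3 / R"
    unfolding R2(1)[symmetric]
    by (rule boundR[OF _ _ _ right_h]) (use \<delta> Rpos in \<open>auto simp: segs len simp del: times_divide_eq_right\<close>)
  have b2: "norm (I G (Complex R (-R)) (Complex R R) - I GN (Complex R (-R)) (Complex R R)) \<le> 6 / R"
    unfolding R2(2)[symmetric]
    by (rule boundR[OF _ _ _ right_v]) (use \<delta> Rpos in \<open>auto simp: segs len simp del: times_divide_eq_right\<close>)
  have b3: "norm (I G (Complex R R) (Complex 0 R) - I GN (Complex R R) (Complex 0 R)) \<le> 3 / R"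
    unfolding R2(1)[symmetric]
    by (rule boundR[OF _ _ _ right_h]) (use \<delta> Rpos in \<open>auto simp: segs len simp del: times_divide_eq_right\<close>)
  have n1: "norm (I GN (Complex 0 R) (Complex (-R) R)) \<le> 6 / R"
    unfolding R2(3)[symmetric]
    by (rule boundN[OF _ _ leftN_h]) (use Rpos in \<open>auto simp: segs len simp del: times_divide_eq_right\<close>)
  have n2: "norm (I GN (Complex (-R) R) (Complex (-R) (-R))) \<le> 12 / R"
    unfolding R2(4)[symmetric]
    by (rule boundN[OF _ _ leftN_v]) (use Rpos in \<open>auto simp: segs len simp del: times_divide_eq_right\<close>)
  have n3: "norm (I GN (Complex (-R) (-R)) (Complex 0 (-R))) \<le> 6 / R"
    unfolding R2(3)[symmetric]
    by (rule boundN[OF _ _ leftN_h]) (use Rpos in \<open>auto simp: segs len simp del: times_divide_eq_right\<close>)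
  have le\<delta>: "6 * C / R * \<delta> \<le> 6 * C / R"
    using C \<delta> R by (intro mult_right_le_one_le) auto
  have "norm (I G (Complex 0 R) (Complex (-\<delta>) R)) \<le> 6 * C / R * \<delta>"
    by (rule boundG[OF _ _ _ leftG_h]) (use C(1) \<delta> Rpos in \<open>auto simp: segs len simp del: times_divide_eq_right\<close>)
  with le\<delta> have g1: "norm (I G (Complex 0 R) (Complex (-\<delta>) R)) \<le> 6 * C / R" by linarith
  have "norm (I G (Complex (-\<delta>) R) (Complex (-\<delta>) (-R))) \<le> 6 * C / \<delta> * (R * real N powr -\<delta>) * (2 * R)"
    by (rule boundG[OF _ _ _ leftG_v])
       (use C(1) \<delta> Rpos in \<open>auto simp: segs len simp del: times_divide_eq_right intro!: mult_nonneg_nonneg\<close>)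
  also have "\<dots> = 12 * C / \<delta> * (R\<^sup>2 * real N powr -\<delta>)" by (simp add: power2_eq_square)
  finally have g2: "norm (I G (Complex (-\<delta>) R) (Complex (-\<delta>) (-R)))
      \<le> 12 * C / \<delta> * (R\<^sup>2 * real N powr -\<delta>)" .
  have "norm (I G (Complex (-\<delta>) (-R)) (Complex 0 (-R))) \<le> 6 * C / R * \<delta>"
    by (rule boundG[OF _ _ _ leftG_h]) (use C(1) \<delta> Rpos in \<open>auto simp: segs len simp del: times_divide_eq_right\<close>)
  with le\<delta> have g3: "norm (I G (Complex (-\<delta>) (-R)) (Complex 0 (-R))) \<le> 6 * C / R" by linarith

  have tri3: "norm (r + s + t) \<le> norm r + norm s + norm t" for r s t :: complex
    using norm_triangle_ineq[of "r + s" t] norm_triangle_ineq[of r s] by linarith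
  have tri: "norm (r1 + r2 + r3 + (l1 + l2 + l3) - (m1 + m2 + m3)) \<le>
      norm r1 + norm r2 + norm r3 + (norm l1 + norm l2 + norm l3) + (norm m1 + norm m2 + norm m3)"
    for r1 r2 r3 l1 l2 l3 m1 m2 m3 :: complex
    using norm_triangle_ineq4[of "r1 + r2 + r3 + (l1 + l2 + l3)" "m1 + m2 + m3"]
      norm_triangle_ineq[of "r1 + r2 + r3" "l1 + l2 + l3"]
      tri3[of r1 r2 r3] tri3[of l1 l2 l3] tri3[of m1 m2 m3] by linarith
  \<comment> \<open>Discarding \<open>2 * pi\<close> costs only a constant. The 36 is 12 from the
    right half plus 24 from the left sides for \<open>GN\<close>; \<open>12 * C\<close> comes from
    the two short horizontal sides for \<open>G\<close>.\<close>
  have "norm (G 0 - GN 0) \<le> 2 * pi * norm (G 0 - GN 0)"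
    using mult_right_mono[of 1 "2 * pi" "norm (G 0 - GN 0)"] pi_ge_two by simp
  also have "\<dots> = norm (2 * pi * \<i> * G 0 - 2 * pi * \<i> * GN 0)"
    by (simp flip: right_diff_distrib add: norm_mult)
  also have "2 * pi * \<i> * G 0 - 2 * pi * \<i> * GN 0 =
      (I G (Complex 0 (-R)) (Complex R (-R)) - I GN (Complex 0 (-R)) (Complex R (-R)))
      + (I G (Complex R (-R)) (Complex R R) - I GN (Complex R (-R)) (Complex R R))
      + (I G (Complex R R) (Complex 0 R) - I GN (Complex R R) (Complex 0 R))
      + (I G (Complex 0 R) (Complex (-\<delta>) R) + I G (Complex (-\<delta>) R) (Complex (-\<delta>) (-R))
        + I G (Complex (-\<delta>) (-R)) (Complex 0 (-R)))
      - (I GN (Complex 0 R) (Complex (-R) R) + I GN (Complex (-R) R) (Complex (-R) (-R))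
        + I GN (Complex (-R) (-R)) (Complex 0 (-R)))"
    unfolding eqG eqN by (simp add: algebra_simps)
  also have "norm \<dots> \<le> 3 / R + 6 / R + 3 / R
      + (6 * C / R + 12 * C / \<delta> * (R\<^sup>2 * real N powr -\<delta>) + 6 * C / R) + (6 / R + 12 / R + 6 / R)"
    by (rule order_trans[OF tri]) (intro add_mono b1 b2 b3 g1 g2 g3 n1 n2 n3)
  also have "\<dots> = (36 + 12 * C) / R + 12 * C / \<delta> * (R\<^sup>2 * real N powr -\<delta>)"
    by (simp add: add_divide_distrib)
  finally show ?thesis by (simp add: GN_def)
qed

section \<open>Nonprincipal characters\<close>

locale nonprincipal_character =
  fixes q :: nat and chi :: "nat \<Rightarrow> complex"
  assumes character: "dirichlet_character q chi"
    and nonprincipal: "chi \<noteq> principal_character q"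
begin

section \<open>Character values and character sums\<close>

lemma q_pos: "q > 0"
  and chi_mult: "chi (m * n) = chi m * chi n"
  and chi_period: "chi (n + q) = chi n"
  and chi_nonzero_iff: "chi n \<noteq> 0 \<longleftrightarrow> coprime n q"
  using character unfolding dirichlet_character_def by blast+

lemma chi_1: "chi 1 = 1"
  using chi_mult[of 1 1] chi_nonzero_iff[of 1] by auto

lemma chi_add_mult: "chi (n + k * q) = chi n"
proof (induction k)
  case (Suc k)
  have "n + Suc k * q = (n + k * q) + q" by simp
  with Suc show ?case by (metis chi_period)
qed simp

lemma chi_mod: "chi (n mod q) = chi n"
  using chi_add_mult[of "n mod q" "n div q"] by (simp add: mod_div_mult_eq)

text \<open>A periodic function is bounded, whereas a value of modulus above 1 would have unbounded
  powers, which are again values of \<open>chi\<close>.\<close>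

lemma norm_chi_le_1: "norm (chi n) \<le> 1"
proof (rule ccontr)
  assume *: "\<not> norm (chi n) \<le> 1"
  have pow: "chi (n ^ k) = chi n ^ k" for k
    by (induction k) (simp_all only: power_0 power_Suc chi_mult chi_1)
  define B where "B = (\<Sum>r<q. norm (chi r))"
  have bound: "norm (chi m) \<le> B" for m
  proof -
    have "norm (chi (m mod q)) \<le> B"
      unfolding B_def by (rule member_le_sum) (use q_pos in auto)
    thus ?thesis by (simp add: chi_mod)
  qed
  obtain k where "B < norm (chi n) ^ k"
    using real_arch_pow[of "norm (chi n)" B] * by auto
  thus False using bound[of "n ^ k"] by (simp add: pow norm_power)
qed

text \<open>Where \<open>chi\<close> differs from the principal character, the argument is coprime
  to \<open>q\<close> and the value is not 1. Multiplication by such an \<open>a\<close> permutes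
  the residues, so the sum equals \<open>chi a\<close> times itself.\<close>

lemma sum_chi_period: "(\<Sum>r<q. chi r) = 0"
proof -
  obtain a where a: "chi a \<noteq> principal_character q a"
    using nonprincipal by blast
  have cop: "coprime a q"
    using a chi_nonzero_iff[of a] by (auto simp: principal_character_def split: if_splits)
  have a1: "chi a \<noteq> 1" using a cop by (simp add: principal_character_def)
  have inj: "inj_on (\<lambda>r. (a * r) mod q) {..<q}"
  proof (rule inj_onI)
    fix x y assume xy: "x \<in> {..<q}" "y \<in> {..<q}" "(a * x) mod q = (a * y) mod q"
    from xy(3) have "[x = y] (mod q)"
      using cop by (simp add: cong_def[symmetric] cong_mult_lcancel_nat)
    thus "x = y" using xy by (simp add: cong_def)
  qed
  have bij: "bij_betw (\<lambda>r. (a * r) mod q) {..<q} {..<q}"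
    unfolding bij_betw_def using inj q_pos
    by (intro conjI endo_inj_surj) auto
  have "(\<Sum>r<q. chi r) = (\<Sum>r<q. chi ((a * r) mod q))"
    using sum.reindex_bij_betw[OF bij, of chi] by simp
  also have "\<dots> = chi a * (\<Sum>r<q. chi r)"
    by (simp add: chi_mod chi_mult sum_distrib_left)
  finally show ?thesis using a1 by simp
qed

lemma norm_sum_chi_le: "norm (\<Sum>n<N. chi n) \<le> real q"
proof (induction N rule: less_induct)
  case (less N)
  show ?case
  proof (cases "N < q")
    case True
    have "norm (\<Sum>n<N. chi n) \<le> (\<Sum>n<N. 1)"
      by (rule sum_norm_le) (use norm_chi_le_1 in auto)
    with True show ?thesis by simp
  next
    case False
    define M where "M = N - q"
    have N: "N = q + M" "M < N" using False q_pos by (auto simp: M_def)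
    have "(\<Sum>n<q + M. chi n) = (\<Sum>n<M. chi n)"
      by (induction M) (simp_all add: sum_chi_period chi_period add.commute[of q])
    thus ?thesis using less[OF N(2)] N(1) by simp
  qed
qed

section \<open>The L-function as an Abel-summed series\<close>

definition chi_sum :: "nat \<Rightarrow> complex" where "chi_sum n = (\<Sum>m=1..n. chi m)"

text \<open>Bounded character sums give the exponent 0. The extra 1 pays for the term
  \<open>chi 0\<close>, which \<open>chi_sum\<close> omits.\<close>

lemma abel_summation_chi: "abel_summation chi_sum (real q + 1) 0"
proof
  fix n
  have "(\<Sum>m<Suc (Suc n). chi m) = chi 0 + (\<Sum>m<Suc n. chi (Suc m))"
    by (rule sum.lessThan_Suc_shift)
  hence "(\<Sum>m<Suc (Suc n). chi m) = chi 0 + chi_sum (Suc n)"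
    by (simp only: chi_sum_def One_nat_def sum.atLeast1_atMost_eq)
  hence "norm (chi_sum (Suc n)) \<le> norm (\<Sum>m<Suc (Suc n). chi m) + norm (chi 0)"
    by (metis add_diff_cancel_left' norm_triangle_ineq4)
  also have "\<dots> \<le> real q + 1"
    using norm_sum_chi_le[of "Suc (Suc n)"] norm_chi_le_1[of 0] by linarith
  finally show "norm (chi_sum (Suc n)) \<le> (real q + 1) * real (Suc n) powr 0" by simp
qed simp

sublocale chi: abel_summation chi_sum "real q + 1" 0
  by (rule abel_summation_chi)

lemma L_sums:
  assumes "Re s > 0"
  shows "dirichlet_L_term chi s sums abel_series chi_sum s"
  using chi.sums[of chi s] assms
  by (simp add: dirichlet_L_term_def[abs_def] chi_sum_def)

lemma dirichlet_L_eq: "Re s > 0 \<Longrightarrow> dirichlet_L chi s = abel_series chi_sum s"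
  using L_sums[of s] by (simp add: dirichlet_L_def sums_iff)

section \<open>The Euler product in logarithmic form\<close>

definition chi_powr :: "complex \<Rightarrow> nat \<Rightarrow> complex" where
  "chi_powr s n = chi n * of_nat n powr -s"

definition prime_term :: "complex \<Rightarrow> nat \<Rightarrow> complex" where
  "prime_term s n = (if prime n then chi_powr s n else 0)"

text \<open>With z = chi(p) p^(-s) and |z| < 1 this is the sum of z^k / k over k \<ge> 2, the
  contribution of the proper powers of one prime to the logarithm of the Euler product.\<close>

definition log_term :: "complex \<Rightarrow> nat \<Rightarrow> complex" where
  "log_term s n = (if prime n then - Ln (1 - chi_powr s n) - chi_powr s n else 0)"

definition log_rest :: "complex \<Rightarrow> complex" where
  "log_rest s = (\<Sum>n. log_term s n)"

lemma norm_chi_powr_le: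
  assumes "Re s \<ge> \<sigma>"
  shows "norm (chi_powr s n) \<le> real n powr -\<sigma>"
proof (cases "n = 0")
  case False
  have "norm (chi_powr s n) \<le> 1 * real n powr (- Re s)"
    unfolding chi_powr_def norm_mult
    by (intro mult_mono norm_chi_le_1) (auto simp: norm_powr_real_powr)
  also have "\<dots> \<le> real n powr -\<sigma>"
    using assms False by (simp add: powr_mono)
  finally show ?thesis .
qed (simp add: chi_powr_def)

text \<open>A bound below 1, uniform in the prime, keeps \<open>1 - chi_powr s n\<close> off the
  branch cut of \<open>Ln\<close>. The value 3/4 exceeds 1/sqrt 2 and yields the factor 4 in
  \<open>norm_log_term_le\<close>.\<close>

lemma norm_chi_powr_prime_le:
  assumes "Re s > 1/2" "prime n"
  shows "norm (chi_powr s n) \<le> 3/4"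
proof -
  have "norm (chi_powr s n) \<le> real n powr -(1/2)"
    by (rule norm_chi_powr_le) (use assms in auto)
  also have "\<dots> \<le> 2 powr -(1/2)"
    using prime_ge_2_nat[OF assms(2)] by (intro powr_mono2') auto
  also have "\<dots> = 1 / sqrt 2" by (simp add: powr_minus powr_half_sqrt field_simps)
  also have "\<dots> \<le> 3/4"
    using real_le_rsqrt[of "4/3" 2] by (simp add: field_simps power2_eq_square)
  finally show ?thesis .
qed

lemma norm_log_term_le:
  assumes "Re s \<ge> \<sigma>" "\<sigma> > 1/2"
  shows "norm (log_term s n) \<le> 4 * real n powr (-2*\<sigma>)"
proof (cases "prime n")
  case True
  define z where "z = chi_powr s n"
  have z: "norm z \<le> 3/4" "norm z \<le> real n powr -\<sigma>"
    unfolding z_def using norm_chi_powr_prime_le[OF _ True, of s] norm_chi_powr_le[OF assms(1), of n] assms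
    by auto
  have "norm (log_term s n) = norm (Ln (1 + (-z)) - (-z))"
    using True norm_minus_cancel[of "Ln (1 - z) + z"] by (simp add: log_term_def z_def)
  also have "\<dots> \<le> norm (-z) ^ 2 / (1 - norm (-z))"
    by (rule Ln_approx_linear) (use z in auto)
  also have "\<dots> \<le> norm z ^ 2 / (1/4)"
    using z(1) unfolding norm_minus_cancel by (intro divide_left_mono) auto
  also have "\<dots> \<le> (real n powr -\<sigma>)\<^sup>2 / (1/4)"
    by (intro divide_right_mono power_mono z) auto
  also have "(real n powr -\<sigma>)\<^sup>2 = real n powr (-2*\<sigma>)"
    by (simp add: power2_eq_square flip: powr_add)
  finally show ?thesis by simp
qed (simp add: log_term_def)

lemma summable_log_bound: "\<sigma> > 1/2 \<Longrightarrow> summable (\<lambda>n. 4 * real n powr (-2*\<sigma>))"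
  by (intro summable_mult) (simp add: summable_real_powr_iff)

lemma holomorphic_log_rest: "log_rest holomorphic_on {s. Re s > 1/2}"
  unfolding log_rest_def[abs_def]
proof (rule holomorphic_suminf_halfplane)
  fix n
  show "(\<lambda>s. log_term s n) holomorphic_on {s. Re s > 1/2}"
  proof (cases "prime n")
    case True
    have "1 - chi_powr s n \<notin> \<real>\<^sub>\<le>\<^sub>0" if "Re s > 1/2" for s
    proof -
      have "Re (chi_powr s n) \<le> 3/4"
        using norm_chi_powr_prime_le[OF that True] complex_Re_le_cmod order_trans by blast
      thus ?thesis by (auto simp: complex_nonpos_Reals_iff)
    qed
    moreover have "(\<lambda>s. chi_powr s n) holomorphic_on {s. Re s > 1/2}"
      unfolding chi_powr_def using True prime_gt_0_nat[OF True] by (intro holomorphic_intros) auto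
    ultimately show ?thesis
      using True unfolding log_term_def by (auto intro!: holomorphic_intros)
  qed (simp add: log_term_def)
next
  fix \<sigma> r :: real assume s: "\<sigma> > 1/2"
  show "\<exists>M. summable M \<and> (\<forall>n s. \<sigma> \<le> Re s \<longrightarrow> cmod s \<le> r \<longrightarrow> cmod (log_term s n) \<le> M n)"
    using summable_log_bound[OF s] norm_log_term_le[OF _ s] by blast
qed

lemma summable_log_term: "Re s > 1/2 \<Longrightarrow> summable (\<lambda>n. norm (log_term s n))"
  by (rule summable_comparison_test'[OF summable_log_bound[of "Re s"], of 0])
     (use norm_log_term_le[OF order_refl] in auto)

lemma log_rest_bounded:
  assumes "\<sigma> > 1/2"
  obtains K where "K \<ge> 0" "\<And>s. Re s \<ge> \<sigma> \<Longrightarrow> norm (log_rest s) \<le> K"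
proof
  show "(\<Sum>n. 4 * real n powr (-2*\<sigma>)) \<ge> 0"
    by (intro suminf_nonneg summable_log_bound assms) auto
  show "norm (log_rest s) \<le> (\<Sum>n. 4 * real n powr (-2*\<sigma>))" if "Re s \<ge> \<sigma>" for s
    unfolding log_rest_def
    by (rule norm_suminf_le[OF norm_log_term_le[OF that assms] summable_log_bound[OF assms]])
qed

lemma summable_chi_powr:
  assumes "Re s > 1" shows "summable (\<lambda>n. norm (chi_powr s n))"
proof (rule summable_comparison_test'[of "\<lambda>n. real n powr (- Re s)" 0])
  show "summable (\<lambda>n. real n powr (- Re s))" using assms by (simp add: summable_real_powr_iff)
qed (use norm_chi_powr_le[OF order_refl] in auto)

lemma norm_prime_term_le: "Re s \<ge> \<sigma> \<Longrightarrow> norm (prime_term s n) \<le> real n powr -\<sigma>"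
  using norm_chi_powr_le by (simp add: prime_term_def)

lemma summable_prime_term:
  assumes "Re s > 1" shows "summable (\<lambda>n. norm (prime_term s n))"
  by (rule summable_comparison_test'[OF summable_chi_powr[OF assms], of 0])
     (auto simp: prime_term_def)

lemma prime_sum_bounded:
  assumes "\<sigma> > 1"
  obtains K where "K \<ge> 0" "\<And>s. Re s \<ge> \<sigma> \<Longrightarrow> norm (\<Sum>n. prime_term s n) \<le> K"
proof
  have *: "summable (\<lambda>n. real n powr -\<sigma>)" using assms by (simp add: summable_real_powr_iff)
  show "(\<Sum>n. real n powr -\<sigma>) \<ge> 0" by (intro suminf_nonneg *) auto
  show "norm (\<Sum>n. prime_term s n) \<le> (\<Sum>n. real n powr -\<sigma>)" if "Re s \<ge> \<sigma>" for s
    by (rule norm_suminf_le[OF norm_prime_term_le[OF that] *])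
qed

text \<open>The exponential form avoids choosing a branch for the whole product: each Euler factor
  has its principal logarithm, and the sum of these need not be the principal logarithm of the
  L-value.\<close>

lemma dirichlet_L_eq_exp:
  assumes s: "Re s > 1"
  shows "dirichlet_L chi s = exp ((\<Sum>n. prime_term s n) + log_rest s)"
proof -
  let ?P = "\<Sum>n. prime_term s n"
  have mult: "chi_powr s (m * n) = chi_powr s m * chi_powr s n" for m n
    by (simp add: chi_powr_def chi_mult powr_times_real)
  have one: "chi_powr s 1 = 1" using chi_1 by (simp add: chi_powr_def)
  have "(\<lambda>n. chi_powr s (Suc n)) sums dirichlet_L chi s"
    using L_sums[of s] s by (simp add: dirichlet_L_eq dirichlet_L_term_def[abs_def] chi_powr_def)
  hence L: "dirichlet_L chi s = (\<Sum>n. chi_powr s n)"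
    by (simp add: sums_Suc_iff sums_iff chi_powr_def[of s 0])
  have "(\<Prod>p | prime p \<and> p \<le> N. 1 - chi_powr s p)
      = exp (- (\<Sum>n<Suc N. prime_term s n + log_term s n))" for N
  proof -
    have nz: "1 - chi_powr s p \<noteq> 0" if "prime p" for p
      using norm_chi_powr_prime_le[OF _ that, of s] s by auto
    have "(\<Prod>p | prime p \<and> p \<le> N. 1 - chi_powr s p)
        = (\<Prod>n<Suc N. if prime n then 1 - chi_powr s n else 1)"
      by (rule prod.mono_neutral_cong_left) auto
    also have "\<dots> = (\<Prod>n<Suc N. exp (- (prime_term s n + log_term s n)))"
      by (rule prod.cong) (auto simp: prime_term_def log_term_def nz[unfolded right_minus_eq])
    also have "\<dots> = exp (- (\<Sum>n<Suc N. prime_term s n + log_term s n))"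
      by (simp only: exp_sum[symmetric] sum_negf finite_lessThan)
    finally show ?thesis .
  qed
  hence lim1: "(\<lambda>N. dirichlet_L chi s * exp (- (\<Sum>n<Suc N. prime_term s n + log_term s n))) \<longlonglongrightarrow> 1"
    using euler_product_tendsto[OF mult one summable_chi_powr[OF s]] unfolding L by simp
  have "(\<lambda>n. prime_term s n + log_term s n) sums (?P + log_rest s)"
    unfolding log_rest_def
    using s by (intro sums_add summable_sums[OF summable_norm_cancel] summable_prime_term
        summable_log_term) auto
  hence "(\<lambda>N. \<Sum>n<Suc N. prime_term s n + log_term s n) \<longlonglongrightarrow> ?P + log_rest s"
    unfolding sums_def by (rule LIMSEQ_Suc)
  hence "(\<lambda>N. dirichlet_L chi s * exp (- (\<Sum>n<Suc N. prime_term s n + log_term s n)))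
      \<longlonglongrightarrow> dirichlet_L chi s * exp (- (?P + log_rest s))"
    by (intro tendsto_intros)
  from LIMSEQ_unique[OF this lim1] show ?thesis
    unfolding exp_minus by (simp add: field_simps)
qed

section \<open>Continuing the prime sum to the left of 1\<close>

lemma holomorphic_prime_sum: "(\<lambda>s. \<Sum>n. prime_term s n) holomorphic_on {s. Re s > 1}"
proof (rule holomorphic_suminf_halfplane)
  fix n
  show "(\<lambda>s. prime_term s n) holomorphic_on {s. Re s > 1}"
    unfolding prime_term_def chi_powr_def
    by (cases "prime n") (auto intro!: holomorphic_intros)
next
  fix \<sigma> r :: real assume s: "\<sigma> > 1"
  show "\<exists>M. summable M \<and> (\<forall>n s. \<sigma> \<le> Re s \<longrightarrow> cmod s \<le> r \<longrightarrow> cmod (prime_term s n) \<le> M n)"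
    by (rule exI[of _ "\<lambda>n. real n powr -\<sigma>"]) (use s norm_prime_term_le in \<open>auto simp: summable_real_powr_iff\<close>)
qed

text \<open>A holomorphic logarithm on the convex zero-free half-plane need not agree with the
  series on \<open>Re s > 1\<close>. Their difference \<open>d\<close> satisfies
  \<open>exp (d s) = 1\<close>, so its derivative is 0; subtracting the constant value of
  \<open>d\<close> selects the right branch.\<close>

lemma log_L_exists:
  assumes \<epsilon>: "0 < \<epsilon>" "\<epsilon> \<le> 1"
    and nz: "\<And>s. Re s > 1 - \<epsilon> \<Longrightarrow> dirichlet_L chi s \<noteq> 0"
  obtains l where "l holomorphic_on {s. Re s > 1 - \<epsilon>}"
    "\<And>s. Re s > 1 - \<epsilon> \<Longrightarrow> exp (l s) = dirichlet_L chi s"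
    "\<And>s. Re s > 1 \<Longrightarrow> l s = (\<Sum>n. prime_term s n) + log_rest s"
proof -
  have holL: "dirichlet_L chi holomorphic_on {s. Re s > 1 - \<epsilon>}"
  proof (rule holomorphic_transform)
    show "abel_series chi_sum holomorphic_on {s. Re s > 1 - \<epsilon>}"
      by (rule holomorphic_on_subset[OF chi.holomorphic]) (use \<epsilon> in auto)
  qed (use \<epsilon> dirichlet_L_eq in auto)
  obtain g where g: "g holomorphic_on {s. Re s > 1 - \<epsilon>}"
    "\<And>s. s \<in> {s. Re s > 1 - \<epsilon>} \<Longrightarrow> exp (g s) = dirichlet_L chi s"
    by (rule holomorphic_logarithm_exists[OF convex_halfspace_Re_gt open_halfspace_Re_gt holL, where ?z0.0 = 1])
       (use nz \<epsilon> in auto)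
  let ?S = "{s. Re s > (1 :: real)}"
  define d where "d s = g s - ((\<Sum>n. prime_term s n) + log_rest s)" for s
  have expd: "exp (d s) = 1" if "Re s > 1" for s
    using g(2)[of s] dirichlet_L_eq_exp[OF that] that \<epsilon> by (simp add: d_def exp_diff)
  have hold: "d holomorphic_on ?S"
    unfolding d_def
    by (intro holomorphic_intros holomorphic_prime_sum holomorphic_on_subset[OF g(1)]
          holomorphic_on_subset[OF holomorphic_log_rest]) (use \<epsilon> in auto)
  have "(d has_field_derivative 0) (at s within ?S)" if s: "s \<in> ?S" for s
  proof -
    have D: "(d has_field_derivative deriv d s) (at s)"
      by (rule holomorphic_derivI[OF hold open_halfspace_Re_gt s])
    hence "((\<lambda>z. exp (d z)) has_field_derivative exp (d s) * deriv d s) (at s)"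
      by (auto intro!: derivative_eq_intros)
    moreover have "((\<lambda>z. exp (d z)) has_field_derivative 0) (at s)"
      by (rule has_field_derivative_transform_within_open[of "\<lambda>_. 1" _ _ ?S])
         (use s expd open_halfspace_Re_gt in auto)
    ultimately have "exp (d s) * deriv d s = 0" by (rule DERIV_unique)
    with D show ?thesis by (simp add: has_field_derivative_at_within)
  qed
  then obtain c where c: "\<And>s. s \<in> ?S \<Longrightarrow> d s = c"
    using has_field_derivative_zero_constant[OF convex_halfspace_Re_gt] by blast
  have expc: "exp c = 1" using expd[of 2] c[of 2] by simp
  show thesis
  proof (rule that)
    show "(\<lambda>s. g s - c) holomorphic_on {s. Re s > 1 - \<epsilon>}"
      by (intro holomorphic_intros g)
    show "exp (g s - c) = dirichlet_L chi s" if "Re s > 1 - \<epsilon>" for s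
      using g(2)[of s] that expc by (simp add: exp_diff)
    show "g s - c = (\<Sum>n. prime_term s n) + log_rest s" if "Re s > 1" for s
      using c[of s] that by (simp add: d_def algebra_simps)
  qed
qed

lemma prime_sum_continuation:
  assumes \<epsilon>: "0 < \<epsilon>" "\<epsilon> \<le> 1/2"
    and nz: "\<And>s. Re s > 1 - \<epsilon> \<Longrightarrow> dirichlet_L chi s \<noteq> 0"
  obtains F C where "F holomorphic_on {s. Re s > 1 - \<epsilon>}"
    "\<And>s. Re s > 1 \<Longrightarrow> F s = (\<Sum>n. prime_term s n)"
    "C \<ge> 0" "\<And>s. 1 - \<epsilon>/3 \<le> Re s \<Longrightarrow> Re s \<le> 1 \<Longrightarrow> norm (F s) \<le> C * (1 + \<bar>Im s\<bar>)"
proof -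
  obtain l where l: "l holomorphic_on {s. Re s > 1 - \<epsilon>}"
    "\<And>s. Re s > 1 - \<epsilon> \<Longrightarrow> exp (l s) = dirichlet_L chi s"
    "\<And>s. Re s > 1 \<Longrightarrow> l s = (\<Sum>n. prime_term s n) + log_rest s"
    using log_L_exists[OF \<epsilon>(1) _ nz] \<epsilon>(2) by auto
  obtain K1 where K1: "K1 \<ge> 0" "\<And>s. Re s \<ge> 1/2 \<Longrightarrow> norm (abel_series chi_sum s) \<le> K1 * norm s"
    using chi.linear_bound[of "1/2"] by auto
  obtain K2 where K2: "K2 \<ge> 0" "\<And>s. Re s \<ge> 2 \<Longrightarrow> norm (\<Sum>n. prime_term s n) \<le> K2"
    using prime_sum_bounded[of 2] by auto
  obtain K3 where K3: "K3 \<ge> 0" "\<And>s. Re s \<ge> 1 - \<epsilon>/3 \<Longrightarrow> norm (log_rest s) \<le> K3"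
    using log_rest_bounded[of "1 - \<epsilon>/3"] \<epsilon> by auto
  define B where "B = 4 * K1 + (K2 + K3) + 1"
  define C where "C = 12 * B / \<epsilon> + (K2 + K3) + K3"
  show thesis
  proof (rule that)
    show "(\<lambda>s. l s - log_rest s) holomorphic_on {s. Re s > 1 - \<epsilon>}"
      by (intro holomorphic_intros l holomorphic_on_subset[OF holomorphic_log_rest]) (use \<epsilon> in auto)
    show "l s - log_rest s = (\<Sum>n. prime_term s n)" if "Re s > 1" for s
      using l(3)[OF that] by simp
    show "C \<ge> 0" using K1 K2 K3 \<epsilon> by (simp add: C_def B_def)
    fix s assume s: "1 - \<epsilon>/3 \<le> Re s" "Re s \<le> 1"
    define t where "t = \<bar>Im s\<bar>"
    \<comment> \<open>At real part 2 the logarithm is bounded uniformly in the height. The disc of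
      radius \<open>1 + \<epsilon>/3\<close> about \<open>c\<close> reaches \<open>s\<close>, and
      the one of radius \<open>1 + 2*\<epsilon>/3\<close> stays where \<open>l\<close> is
      holomorphic; the gap \<open>\<epsilon>/3\<close> puts the factor 1/\<epsilon> into
      \<open>C\<close>.\<close>
    define c where "c = Complex 2 (Im s)"
    have t: "t \<ge> 0" by (simp add: t_def)
    define A where "A = K1 * (4 + t) + (K2 + K3) + 1"
    have A: "A \<ge> 0" "A \<le> B * (1 + t)"
      using K1 K2 K3 t by (auto simp: A_def B_def algebra_simps)
    have lc: "norm (l c) \<le> K2 + K3"
      using l(3)[of c] K2(2)[of c] K3(2)[of c] norm_triangle_mono \<epsilon> by (auto simp: c_def)
    have sub: "Re z > 1 - 2*\<epsilon>/3 \<and> norm z \<le> 4 + t" if "z \<in> ball c (1 + 2*\<epsilon>/3)" for z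
    proof -
      have n: "norm (c - z) < 1 + 2*\<epsilon>/3" using that by (simp add: dist_norm)
      have "Re (c - z) \<le> norm (c - z)" by (rule complex_Re_le_cmod)
      with n have "Re z > 1 - 2*\<epsilon>/3" by (simp add: c_def)
      moreover have "norm c \<le> 2 + t" using cmod_le[of c] by (simp add: c_def t_def)
      hence "norm z \<le> 4 + t" using norm_triangle_sub[of z c] n \<epsilon> by (simp add: norm_minus_commute)
      ultimately show ?thesis by blast
    qed
    have "norm (l s - l c) \<le> 2 * A * (1 + \<epsilon>/3) / ((1 + 2*\<epsilon>/3) - (1 + \<epsilon>/3))"
    proof (rule borel_caratheodory[where f = l and c = c])
      show "l holomorphic_on ball c (1 + 2*\<epsilon>/3)"
        by (rule holomorphic_on_subset[OF l(1)]) (use sub \<epsilon> in force)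
      show "s \<in> cball c (1 + \<epsilon>/3)"
      proof -
        have "c - s = of_real (2 - Re s)" by (simp add: c_def complex_eq_iff)
        hence "norm (c - s) = \<bar>2 - Re s\<bar>" by (metis norm_of_real)
        thus ?thesis using s by (simp add: dist_norm)
      qed
      fix z assume z: "z \<in> ball c (1 + 2*\<epsilon>/3)"
      have z1: "Re z > 1 - \<epsilon>" "Re z \<ge> 1/2" using sub[OF z] \<epsilon> by auto
      \<comment> \<open>\<open>Re (l z)\<close> is log |L|, for which the linear upper bound of |L|
        is good enough. No lower bound on |L| enters, because Borel--Caratheodory is
        one-sided.\<close>
      have "Re (l z) < exp (Re (l z))" using exp_ge_add_one_self[of "Re (l z)"] by linarith
      also have "\<dots> = norm (dirichlet_L chi z)" using l(2)[OF z1(1)] by (metis norm_exp_eq_Re)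
      also have "\<dots> = norm (abel_series chi_sum z)" using z1 by (simp add: dirichlet_L_eq)
      also have "\<dots> \<le> K1 * norm z" by (rule K1(2)[OF z1(2)])
      also have "\<dots> \<le> K1 * (4 + t)" using sub[OF z] K1 by (intro mult_left_mono) auto
      finally have "Re (l z) < K1 * (4 + t)" .
      moreover have "- Re (l c) \<le> norm (l c)" using abs_Re_le_cmod[of "l c"] by linarith
      ultimately show "Re (l z - l c) < A" using lc by (simp add: A_def)
    qed (use \<epsilon> in auto)
    also have "\<dots> = 6 * A * (1 + \<epsilon>/3) / \<epsilon>" using \<epsilon> by (simp add: field_simps)
    also have "\<dots> \<le> 6 * A * 2 / \<epsilon>"
      using \<epsilon> A by (intro divide_right_mono mult_left_mono) auto
    also have "\<dots> \<le> 12 * (B * (1 + t)) / \<epsilon>"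
      using \<epsilon> A by (intro divide_right_mono) auto
    finally have "norm (l s - l c) \<le> 12 * B / \<epsilon> * (1 + t)" by simp
    moreover have "norm (l s - log_rest s) \<le> norm (l s - l c) + norm (l c) + norm (log_rest s)"
      using norm_triangle_ineq4[of "l s" "log_rest s"] norm_triangle_sub[of "l s" "l c"] by linarith
    ultimately have "norm (l s - log_rest s) \<le> 12 * B / \<epsilon> * (1 + t) + (K2 + K3) + K3"
      using lc K3(2)[OF s(1)] by linarith
    also have "\<dots> \<le> C * (1 + t)"
    proof -
      have "((K2 + K3) + K3) * 1 \<le> ((K2 + K3) + K3) * (1 + t)"
        using K2 K3 t by (intro mult_left_mono) auto
      thus ?thesis unfolding C_def distrib_right[of _ _ "1 + t"] by simp
    qed
    finally show "norm (l s - log_rest s) \<le> C * (1 + \<bar>Im s\<bar>)" by (simp add: t_def)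
  qed
qed

section \<open>Rate at 1 and convergence to the left of 1\<close>

lemma prime_term_add: "n > 0 \<Longrightarrow> prime_term s n * of_nat n powr -z = prime_term (s + z) n"
  by (simp add: prime_term_def chi_powr_def powr_diff powr_minus divide_inverse)

lemma prime_sum_estimate:
  assumes \<epsilon>: "0 < \<epsilon>" "\<epsilon> \<le> 1/2"
    and nz: "\<And>s. Re s > 1 - \<epsilon> \<Longrightarrow> dirichlet_L chi s \<noteq> 0"
  obtains F0 K where
    "\<And>N. N \<ge> 1 \<Longrightarrow> norm ((\<Sum>n\<le>N. prime_term 1 n) - F0) \<le> K * real N powr -(\<epsilon>/9)"
proof -
  obtain F C where F: "F holomorphic_on {s. Re s > 1 - \<epsilon>}"
    "\<And>s. Re s > 1 \<Longrightarrow> F s = (\<Sum>n. prime_term s n)"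
    "C \<ge> 0" "\<And>s. 1 - \<epsilon>/3 \<le> Re s \<Longrightarrow> Re s \<le> 1 \<Longrightarrow> norm (F s) \<le> C * (1 + \<bar>Im s\<bar>)"
    using prime_sum_continuation[OF \<epsilon> nz] by blast
  define a where "a n = (if prime n then chi n else 0)" for n
  have a: "a n * of_nat n powr -s = prime_term s n" for n s
    by (simp add: a_def prime_term_def chi_powr_def)
  define K where "K = 36 + 12 * C + 12 * C / (\<epsilon>/3)"
  show thesis
  proof (rule that[of "F 1" K])
    fix N :: nat assume N: "N \<ge> 1"
    \<comment> \<open>With \<delta> = \<epsilon>/3 this choice makes both errors, 1/R and R^2
      N^(-\<delta>), equal to N^(-\<epsilon>/9).\<close>
    define R where "R = real N powr (\<epsilon>/9)"
    have "real N powr 0 \<le> R" "R \<le> real N powr 1"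
      unfolding R_def using N \<epsilon> by (intro powr_mono; simp)+
    hence R: "1 \<le> R" "R \<le> real N" using N by auto
    have "R\<^sup>2 * real N powr -(\<epsilon>/3) = real N powr (\<epsilon>/9 + \<epsilon>/9 + -(\<epsilon>/3))"
      by (simp only: R_def power2_eq_square powr_add)
    also have "\<epsilon>/9 + \<epsilon>/9 + -(\<epsilon>/3) = -(\<epsilon>/9)" by simp
    finally have pow: "R\<^sup>2 * real N powr -(\<epsilon>/3) = real N powr -(\<epsilon>/9)" "1 / R = real N powr -(\<epsilon>/9)"
      by (simp_all add: R_def powr_minus_divide)
    have "norm ((\<lambda>z. F (1 + z)) 0 - (\<Sum>n\<le>N. a n * of_nat n powr -1))
       \<le> (36 + 12 * C) / R + 12 * C / (\<epsilon>/3) * (R\<^sup>2 * real N powr -(\<epsilon>/3))"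
    proof (rule newman_estimate[where \<delta>' = \<epsilon>])
      show "norm (a n) \<le> 1" for n using norm_chi_le_1 by (simp add: a_def)
      show "(\<lambda>z. F (1 + z)) holomorphic_on {z. - \<epsilon> < Re z}"
        by (intro holomorphic_on_compose_gen[OF _ F(1), unfolded o_def] holomorphic_intros) auto
      show "F (1 + z) = (\<Sum>n. a n * of_nat n powr -(1 + z))" if "Re z > 0" for z
        using F(2)[of "1 + z"] that unfolding a by simp
      show "norm (F (1 + z)) \<le> C * (1 + \<bar>Im z\<bar>)" if "- (\<epsilon>/3) \<le> Re z" "Re z \<le> 0" for z
        using F(4)[of "1 + z"] that by simp
    qed (use \<epsilon> F R in auto)
    also have "(36 + 12 * C) / R = (36 + 12 * C) * real N powr -(\<epsilon>/9)"
      unfolding pow(2)[symmetric] by simp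
    also have "\<dots> + 12 * C / (\<epsilon>/3) * (R\<^sup>2 * real N powr -(\<epsilon>/3)) = K * real N powr -(\<epsilon>/9)"
      unfolding pow(1) K_def distrib_right ..
    finally show "norm ((\<Sum>n\<le>N. prime_term 1 n) - F 1) \<le> K * real N powr -(\<epsilon>/9)"
      unfolding a by (simp add: norm_minus_commute)
  qed
qed

text \<open>The first prime at which the character does not vanish dominates the series for large s.\<close>
lemma prime_sum_not_identically_zero: "\<exists>x>0. (\<Sum>n. prime_term (of_real (1 + x)) n) \<noteq> 0"
proof (rule ccontr)
  assume "\<not> ?thesis"
  hence zero: "(\<Sum>n. prime_term (of_real (1 + x)) n) = 0" if "x > 0" for x :: real
    using that by blast
  obtain p0 where "prime p0" "p0 > q" using bigger_prime by blast
  moreover from this have "\<not> p0 dvd q" using q_pos nat_dvd_not_less by blast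
  ultimately have ex: "prime p0 \<and> chi p0 \<noteq> 0"
    using chi_nonzero_iff[of p0] prime_imp_coprime[of p0 q] by blast
  define p where "p = (LEAST n. prime n \<and> chi n \<noteq> 0)"
  have p: "prime p" "chi p \<noteq> 0" "\<And>n. n < p \<Longrightarrow> \<not> (prime n \<and> chi n \<noteq> 0)"
    using LeastI[of "\<lambda>n. prime n \<and> chi n \<noteq> 0", OF ex]
      not_less_Least[of _ "\<lambda>n. prime n \<and> chi n \<noteq> 0"] unfolding p_def by blast+
  have p1: "p \<ge> 1" using prime_gt_0_nat[OF p(1)] by simp
  have bound: "norm (chi p) \<le> real p / x" if x: "x > 0" for x :: real
  proof -
    let ?s = "of_real (1 + x) :: complex"
    have le: "norm (prime_term ?s n) \<le> real n powr (-x - 1)" for n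
      using norm_prime_term_le[of "1 + x" ?s n] by (simp add: minus_diff_commute)
    have sm: "summable (prime_term ?s)"
      by (rule summable_norm_cancel[OF summable_prime_term]) (use x in simp)
    have "(\<Sum>n<p. prime_term ?s n) = 0"
      by (rule sum.neutral) (use p(3) in \<open>auto simp: prime_term_def chi_powr_def\<close>)
    hence "(\<Sum>n<Suc p. prime_term ?s n) = prime_term ?s p" by simp
    hence "prime_term ?s p = - (\<Sum>n. prime_term ?s (n + Suc p))"
      using suminf_split_initial_segment[OF sm, of "Suc p"] zero[OF x]
      by (simp add: add_eq_0_iff del: sum.lessThan_Suc)
    hence "norm (prime_term ?s p) = norm (\<Sum>n. prime_term ?s (n + Suc p))" by simp
    also have "\<dots> \<le> (\<Sum>n. real (n + Suc p) powr (-x - 1))"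
      by (rule norm_suminf_le[OF le powr_tail_sum_le(1)[OF x p1]])
    also have "\<dots> \<le> real p powr -x / x" by (rule powr_tail_sum_le(2)[OF x p1])
    also have "norm (prime_term ?s p) = norm (chi p) * real p powr (-x - 1)"
      using p(1) by (simp add: prime_term_def chi_powr_def norm_mult norm_powr_real_powr minus_diff_commute)
    also have "real p powr (-x - 1) = real p powr -x / real p"
      using p1 by (simp add: powr_diff)
    finally show ?thesis using p1 x by (simp add: field_simps)
  qed
  have "norm (chi p) > 0" using p by simp
  \<comment> \<open>The argument \<open>x\<close> is chosen so that \<open>real p / x\<close> is
    half of \<open>norm (chi p)\<close>.\<close>
  moreover have "norm (chi p) \<le> norm (chi p) / 2"
    using bound[of "2 * real p / norm (chi p)"] p p1 by simp
  ultimately show False by linarith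
qed

lemma prime_sum_converges_nonzero:
  assumes \<epsilon>: "0 < \<epsilon>" "\<epsilon> \<le> 1/2"
    and nz: "\<And>s. Re s > 1 - \<epsilon> \<Longrightarrow> dirichlet_L chi s \<noteq> 0"
  obtains \<sigma> l where "1 - \<epsilon> < \<sigma>" "\<sigma> < 1" "l \<noteq> 0" "prime_term (of_real \<sigma>) sums l"
proof -
  obtain F0 K where F0: "\<And>N. N \<ge> 1 \<Longrightarrow>
      norm ((\<Sum>n\<le>N. prime_term 1 n) - F0) \<le> K * real N powr -(\<epsilon>/9)"
    using prime_sum_estimate[OF \<epsilon> nz] by blast
  define \<eta> where "\<eta> = \<epsilon>/9"
  have \<eta>: "0 < \<eta>" "\<eta> < \<epsilon>" "\<eta> \<le> 1" using \<epsilon> by (auto simp: \<eta>_def)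
  \<comment> \<open>Subtracting the limit turns bounded partial sums into a sequence of size
    N^(-\<eta>). The constant cancels in \<open>E (Suc n) - E n\<close>, and \<open>E 0\<close> is
    subtracted again in \<open>D\<close>.\<close>
  define E where "E N = (\<Sum>n\<le>N. prime_term 1 n) - F0" for N
  interpret abel_summation E K "-\<eta>"
    by unfold_locales (use F0 \<eta> in \<open>auto simp: E_def \<eta>_def simp del: of_nat_Suc sum.atMost_Suc\<close>)
  define D where "D s = abel_series E s - E 0" for s
  have D_sums: "prime_term (1 + s) sums D s" if "Re s > -\<eta>" for s
  proof -
    have "(\<lambda>n. prime_term 1 (Suc n) * of_nat (Suc n) powr -s) sums D s"
      unfolding D_def by (rule sums) (use that in \<open>auto simp: E_def\<close>)
    hence "(\<lambda>n. prime_term (1 + s) (Suc n)) sums D s"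
      by (simp only: prime_term_add zero_less_Suc)
    thus ?thesis by (simp add: sums_Suc_iff prime_term_def[of _ 0])
  qed
  have "\<exists>x. -\<eta> < x \<and> x < 0 \<and> D (of_real x) \<noteq> 0"
  proof (rule ccontr)
    assume contra: "\<not> ?thesis"
    \<comment> \<open>This set accumulates at 0, an interior point of the half-plane, so vanishing
      on it would spread to the positive reals, where the series is known not to vanish
      identically.\<close>
    let ?U = "of_real ` {-\<eta><..<0} :: complex set"
    have "D s = 0" if s: "Re s > -\<eta>" for s
    proof (rule analytic_continuation[where f = D and w = s and S = "{s. Re s > -\<eta>}" and U = ?U and \<xi> = 0])
      show "D holomorphic_on {s. Re s > -\<eta>}"
        unfolding D_def by (intro holomorphic_intros holomorphic)
      show "0 islimpt ?U"
        unfolding islimpt_approachable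
      proof (intro allI impI)
        fix e :: real assume e: "e > 0"
        define x where "x = - min (e/2) (\<eta>/2)"
        have "-\<eta> < x" "x < 0" "\<bar>x\<bar> < e" using e \<eta> by (auto simp: x_def min_def)
        thus "\<exists>z\<in>?U. z \<noteq> 0 \<and> dist z 0 < e"
          by (intro bexI[of _ "of_real x"]) auto
      qed
    qed (use contra s \<eta> convex_connected[OF convex_halfspace_Re_gt] open_halfspace_Re_gt in auto)
    hence "prime_term (1 + of_real x) sums 0" if "x > 0" for x :: real
      using D_sums[of "of_real x"] that \<eta> by simp
    thus False using prime_sum_not_identically_zero by (auto simp: sums_iff)
  qed
  then obtain x where x: "-\<eta> < x" "x < 0" "D (of_real x) \<noteq> 0" by blast
  show thesis
  proof (rule that)
    show "prime_term (of_real (1 + x)) sums D (of_real x)"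
      using D_sums[of "of_real x"] x by simp
  qed (use x \<eta> in auto)
qed

section \<open>From the complex series to the real partial sums\<close>

lemma Re_prime_term:
  "Re (prime_term (of_real \<sigma>) p) = (if prime p then Re (chi p) * real p powr -\<sigma> else 0)"
  using powr_of_real[of "real p" "-\<sigma>"] by (simp add: prime_term_def chi_powr_def)

lemma prime_partial_sum_eq:
  "prime_partial_sum chi \<sigma> x = Re (\<Sum>n<Suc (nat \<lfloor>x\<rfloor>). prime_term (of_real \<sigma>) n)"
proof -
  have "(\<Sum>p | prime p \<and> real p \<le> x. Re (chi p) * real p powr -\<sigma>)
      = (\<Sum>n<Suc (nat \<lfloor>x\<rfloor>). if prime n then Re (chi n) * real n powr -\<sigma> else 0)"
  proof (rule sum.mono_neutral_cong_left)
    show "{p. prime p \<and> real p \<le> x} \<subseteq> {..<Suc (nat \<lfloor>x\<rfloor>)}"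
      by (auto simp: le_nat_floor less_Suc_eq_le)
    show "\<forall>n\<in>{..<Suc (nat \<lfloor>x\<rfloor>)} - {p. prime p \<and> real p \<le> x}.
        (if prime n then Re (chi n) * real n powr -\<sigma> else 0) = 0"
    proof
      fix n assume n: "n \<in> {..<Suc (nat \<lfloor>x\<rfloor>)} - {p. prime p \<and> real p \<le> x}"
      have "\<not> prime n"
      proof
        assume p: "prime n"
        \<comment> \<open>Positivity covers negative \<open>x\<close>, for which
          \<open>nat \<lfloor>x\<rfloor>\<close> is 0 and lies above \<open>x\<close>.\<close>
        hence "n > 0" "n \<le> nat \<lfloor>x\<rfloor>" using n prime_gt_0_nat by auto
        hence "real n \<le> x" by linarith
        with n p show False by simp
      qed
      thus "(if prime n then Re (chi n) * real n powr -\<sigma> else 0) = 0" by simp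
    qed
  qed auto
  thus ?thesis by (simp add: prime_partial_sum_def Re_prime_term del: sum.lessThan_Suc)
qed

end

theorem theorem1p2:
  fixes q :: nat and chi :: "nat \<Rightarrow> complex" and \<epsilon> :: real
  assumes "dirichlet_character q chi"
    and "real_character chi"
    and "chi \<noteq> principal_character q"
    and "\<epsilon> > 0"
    and "\<And>s :: complex. Re s > 1 - \<epsilon> \<Longrightarrow> dirichlet_L chi s \<noteq> 0"
  shows "\<exists>\<sigma>::real. 1 - \<epsilon> < \<sigma> \<and> \<sigma> < 1 \<and>
           finitely_many_sign_changes (prime_partial_sum chi \<sigma>)"
proof -
  interpret nonprincipal_character q chi
    by unfold_locales (fact assms)+
  define \<epsilon>' where "\<epsilon>' = min \<epsilon> (1/2)"
  have \<epsilon>': "0 < \<epsilon>'" "\<epsilon>' \<le> 1/2" "\<epsilon>' \<le> \<epsilon>" using assms(4) by (auto simp: \<epsilon>'_def)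
  have nz: "dirichlet_L chi s \<noteq> 0" if "Re s > 1 - \<epsilon>'" for s
    using assms(5)[of s] that \<epsilon>' by simp
  obtain \<sigma> l where \<sigma>: "1 - \<epsilon>' < \<sigma>" "\<sigma> < 1" and l: "l \<noteq> 0" "prime_term (of_real \<sigma>) sums l"
    using prime_sum_converges_nonzero[OF \<epsilon>'(1,2) nz] by blast
  \<comment> \<open>Since \<open>l \<noteq> 0\<close> alone does not exclude a purely imaginary
    limit, \<open>l\<close> is shown to be real before its real part is used.\<close>
  have "prime_term (of_real \<sigma>) n \<in> \<real>" for n
    using assms(2) powr_of_real[of "real n" "-\<sigma>"]
    by (simp add: real_character_def prime_term_def chi_powr_def)
  hence "(\<Sum>n<N. prime_term (of_real \<sigma>) n) \<in> \<real>" for N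
    by (intro sum_in_Reals)
  hence "l \<in> \<real>"
    using closed_sequentially[OF closed_complex_Reals _ l(2)[unfolded sums_def]] by blast
  hence Rel: "Re l \<noteq> 0" using l(1) by (auto elim: Reals_cases)
  have lim: "(\<lambda>N. Re (\<Sum>n<Suc N. prime_term (of_real \<sigma>) n)) \<longlonglongrightarrow> Re l"
    using l(2) unfolding sums_def by (intro tendsto_Re LIMSEQ_Suc)
  have "\<exists>M. (\<forall>N\<ge>M. Re (\<Sum>n<Suc N. prime_term (of_real \<sigma>) n) \<ge> 0) \<or>
            (\<forall>N\<ge>M. Re (\<Sum>n<Suc N. prime_term (of_real \<sigma>) n) \<le> 0)"
  proof (cases "Re l > 0")
    case True
    from order_tendstoD(1)[OF lim this] show ?thesis
      unfolding eventually_sequentially by (meson less_imp_le)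
  next
    case False
    with Rel have "Re l < 0" by simp
    from order_tendstoD(2)[OF lim this] show ?thesis
      unfolding eventually_sequentially by (meson less_imp_le)
  qed
  then obtain M where M: "(\<forall>N\<ge>M. Re (\<Sum>n<Suc N. prime_term (of_real \<sigma>) n) \<ge> 0) \<or>
            (\<forall>N\<ge>M. Re (\<Sum>n<Suc N. prime_term (of_real \<sigma>) n) \<le> 0)" by blast
  have "nat \<lfloor>x\<rfloor> \<ge> M" if "x \<ge> real M + 1" for x :: real
    using that by linarith
  hence "finitely_many_sign_changes (prime_partial_sum chi \<sigma>)"
    unfolding finitely_many_sign_changes_def prime_partial_sum_eq
    using M by (intro exI[of _ "real M + 1"]) auto
  thus ?thesis using \<sigma> \<epsilon>' by (intro exI[of _ \<sigma>]) auto
qed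

end
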